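(* Fix $d\geq 2$. For any nonempty open set $\Omega\subset\mathbb{R}^d$ and any $\alpha\in\mathbb{N}^d$ with $|\alpha|=d$, there exists a Borel probability measure $P$ on $\mathbb{R}^d$ with a continuous density $f_P\in\mathcal{C}^0_c(\Omega)$ compactly supported in $\Omega$ such that the distributional derivative $\partial^\alpha F_P^{\mathrm g}$ of $F_P^{\mathrm g}$ is not a bounded map on $\Omega$ (i.e. its restriction to $\Omega$ is not in $L^\infty(\Omega)$). In particular, $F_P^{\mathrm g}\in\mathcal{C}^{d-1}(\mathbb{R}^d)\setminus\mathcal{C}^d(\Omega)$.
   Context: $F_P^{\mathrm g}:\mathbb{R}^d\to\mathbb{R}^d$ is the geometric cdf of $P$: $F_P^{\mathrm g}(x)=\mathbb{E}\big[\frac{x-Z}{\|x-Z\|}\mathbb{I}[Z\neq x]\big]$, where $Z$ is a random vector with law $P$. Derivatives act componentwise. $\mathcal{C}^0_c(\Omega)$ is the set of continuous functions with compact support contained in $\Omega$. *)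

theory Defs
  imports "HOL-Probability.Probability"
begin

definition geometric_cdf :: "(real ^ 'n) measure \<Rightarrow> real ^ 'n \<Rightarrow> real ^ 'n" where
  "geometric_cdf P x =
     (\<integral>z. indicator {z. z \<noteq> x} z *\<^sub>R ((x - z) /\<^sub>R norm (x - z)) \<partial>P)"

definition partial_deriv ::
    "'n::finite \<Rightarrow> (real ^ 'n \<Rightarrow> 'b::real_normed_vector) \<Rightarrow> real ^ 'n \<Rightarrow> 'b" where
  "partial_deriv i f x = vector_derivative (\<lambda>t. f (x + t *\<^sub>R axis i 1)) (at 0)"

text \<open>
  A multi-index is a function from the coordinate type to the naturals. The choice of
  an order of differentiation (a list in which each coordinate \<open>i\<close> occurs exactly
  \<open>\<alpha> i\<close> times) is immaterial on functions whose partial derivatives up to order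
  \<open>sum \<alpha> UNIV\<close> exist and are continuous, by the symmetry of mixed partial derivatives;
  below, \<open>multi_deriv\<close> is only applied to test functions.
\<close>
definition multi_deriv ::
    "('n::finite \<Rightarrow> nat) \<Rightarrow> (real ^ 'n \<Rightarrow> 'b::real_normed_vector) \<Rightarrow> real ^ 'n \<Rightarrow> 'b" where
  "multi_deriv \<alpha> f = foldr partial_deriv (SOME is. \<forall>i. count_list is i = \<alpha> i) f"

text \<open>
  Functions on an open set \<open>S\<close> are represented by total functions, of which only the values
  on \<open>S\<close> matter here.
\<close>
primrec C_k :: "nat \<Rightarrow> (real ^ 'n::finite) set \<Rightarrow> (real ^ 'n \<Rightarrow> 'b::real_normed_vector) set" where
  "C_k 0 S = {f. continuous_on S f}"
| "C_k (Suc k) S =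
     {f. continuous_on S f \<and>
         (\<forall>i. (\<forall>x\<in>S. (\<lambda>t. f (x + t *\<^sub>R axis i 1)) differentiable (at 0)) \<and>
              partial_deriv i f \<in> C_k k S)}"

definition compact_support_in :: "'a::topological_space set \<Rightarrow> ('a \<Rightarrow> 'b::zero) \<Rightarrow> bool" where
  "compact_support_in S f \<longleftrightarrow> compact (closure {x. f x \<noteq> 0}) \<and> closure {x. f x \<noteq> 0} \<subseteq> S"

text \<open>
  Functions compactly supported in \<open>S\<close> are identified with their extension by zero, so
  that continuity and smoothness are required on the whole space.
\<close>
definition C0_c :: "(real ^ 'n) set \<Rightarrow> (real ^ 'n \<Rightarrow> real) set" where
  "C0_c S = {f. continuous_on UNIV f \<and> compact_support_in S f}"

definition test_functions :: "(real ^ 'n::finite) set \<Rightarrow> (real ^ 'n \<Rightarrow> real) set" where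
  "test_functions S = {\<phi>. (\<forall>k. \<phi> \<in> C_k k UNIV) \<and> compact_support_in S \<phi>}"

text \<open>
  Distributions with values in \<open>'b\<close> (componentwise, for \<open>'b\<close> a Euclidean space) are
  represented by functionals on real-valued functions, of which only the values on test
  functions matter.
\<close>
definition distribution_of ::
    "(real ^ 'n::finite \<Rightarrow> 'b::{banach,second_countable_topology})
     \<Rightarrow> (real ^ 'n \<Rightarrow> real) \<Rightarrow> 'b" where
  "distribution_of f \<phi> = (\<integral>x. \<phi> x *\<^sub>R f x \<partial>lebesgue)"

definition distributional_deriv ::
    "('n::finite \<Rightarrow> nat) \<Rightarrow> ((real ^ 'n \<Rightarrow> real) \<Rightarrow> 'b::real_normed_vector)
     \<Rightarrow> (real ^ 'n \<Rightarrow> real) \<Rightarrow> 'b" where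
  "distributional_deriv \<alpha> T \<phi> = (- 1) ^ (\<Sum>i\<in>UNIV. \<alpha> i) *\<^sub>R T (multi_deriv \<alpha> \<phi>)"

definition L_infinity ::
    "(real ^ 'n::finite) set \<Rightarrow> (real ^ 'n \<Rightarrow> 'b::{banach,second_countable_topology}) set" where
  "L_infinity S =
     {g. g \<in> borel_measurable (lebesgue_on S) \<and> (\<exists>C. AE x in lebesgue_on S. norm (g x) \<le> C)}"

definition restricts_to_L_infinity ::
    "(real ^ 'n::finite) set
     \<Rightarrow> ((real ^ 'n \<Rightarrow> real) \<Rightarrow> 'b::{banach,second_countable_topology}) \<Rightarrow> bool" where
  "restricts_to_L_infinity S T \<longleftrightarrow>
     (\<exists>g\<in>L_infinity S. \<forall>\<phi>\<in>test_functions S. T \<phi> = (\<integral>x. \<phi> x *\<^sub>R g x \<partial>lebesgue_on S))"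

end

theory Submission
  imports Defs
begin

text \<open>
  For a measure with density \<open>f\<close>, the geometric cdf \<open>F\<close> is the convolution of \<open>f\<close> with the kernel
  \<open>K x = x / norm x\<close>. This kernel is smooth off the origin and homogeneous of degree \<open>0\<close>, so each
  of its derivatives of order \<open>m\<close> is homogeneous of degree \<open>-m\<close>, which in dimension \<open>d\<close> is locally
  integrable exactly as long as \<open>m < d\<close>. For \<open>m \<le> d - 1\<close> the derivatives may therefore be moved onto
  \<open>K\<close> under the integral (\<open>conv_has_partial\<close>), which gives \<open>C\<^sup>d\<^sup>-\<^sup>1\<close> regularity for every continuous
  compactly supported \<open>f\<close> (\<open>conv_C_k\<close>).

  At order \<open>d\<close> integrability fails, but only logarithmically. The derivative \<open>D = \<partial>\<^sup>\<alpha> K\<close> does not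
  vanish identically (\<open>iterated_partial_sign_kernel_nonzero\<close>), so it stays in a fixed half space
  on a cone around some vector \<open>v\<close>. Let \<open>\<beta>\<close> be a small bump around \<open>-v\<close> and
  \<open>f (x\<^sub>0 + z) = c * (\<Sum>k. \<beta> (2\<^sup>k z) / (k + 1))\<close>. The summands have disjoint supports and their
  heights tend to \<open>0\<close>, so \<open>f\<close> is continuous; by homogeneity each of them contributes
  the same amount, up to the factor \<open>1 / (k + 1)\<close>, to the integral of \<open>f z *\<^sub>R D (x\<^sub>0 - z)\<close>. The
  harmonic series diverges, and \<open>\<partial>\<^sup>\<alpha> F\<close> blows up at \<open>x\<^sub>0\<close>.

  The distribution \<open>\<partial>\<^sup>\<alpha> K\<close> is not a locally integrable function, so the
  blow-up is made precise by testing. Let \<open>\<psi>\<^sub>N x = \<phi> (2\<^sup>N (x - x\<^sub>0))\<close> for a smooth bump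
  \<open>\<phi>\<close>. By Fubini and scaling, the pairing of \<open>\<partial>\<^sup>\<alpha> \<psi>\<^sub>N\<close> with \<open>F\<close> is the integral of
  \<open>f z *\<^sub>R h (2\<^sup>N (z - x\<^sub>0))\<close>, where \<open>h\<close> is the correlation of \<open>\<partial>\<^sup>\<alpha> \<phi>\<close> with \<open>K\<close>.
  The function \<open>h\<close> is bounded, and far from the support of \<open>\<phi>\<close> integration by parts turns it into
  an average of \<open>D\<close> (\<open>corr_derivative_lower_bound\<close>). Hence the shells \<open>k \<le> N\<close> contribute at
  least a constant times \<open>2\<^sup>-\<^sup>N\<^sup>d\<close> times a partial sum of the harmonic series, and the remaining ones at most
  \<open>2\<^sup>-\<^sup>N\<^sup>d\<close> times a constant (\<open>dyadic_pairing_lower_bound\<close>). Since the integral of \<open>\<psi>\<^sub>N\<close> is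
  \<open>2\<^sup>-\<^sup>N\<^sup>d\<close> times that of \<open>\<phi>\<close>, the pairing is not bounded by a multiple of the
  integral of the test function (\<open>unbounded_derivative_functional\<close>). Both an \<open>L\<^sup>\<infinity>\<close>
  representative of \<open>\<partial>\<^sup>\<alpha> F\<close> on \<open>\<Omega>\<close> and, after integration by parts, membership of \<open>F\<close> in
  \<open>C\<^sup>d(\<Omega>)\<close> would give such a bound for test functions supported in a fixed compact ball.
\<close>

section \<open>Iterated partial derivatives\<close>

lemma partial_deriv_eqI:
  "((\<lambda>t. f (x + t *\<^sub>R axis i 1)) has_vector_derivative D) (at 0) \<Longrightarrow> partial_deriv i f x = D"
  unfolding partial_deriv_def by (rule vector_derivative_at)

lemma C_k_continuous_on: "f \<in> C_k k S \<Longrightarrow> continuous_on S f"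
  by (cases k) auto

lemma C_k_has_partial:
  assumes "f \<in> C_k (Suc k) S" "x \<in> S"
  shows "((\<lambda>t. f (x + t *\<^sub>R axis i 1)) has_vector_derivative partial_deriv i f x) (at 0)"
  using assms unfolding partial_deriv_def by (auto simp: vector_derivative_works)

lemma has_partial_shift:
  assumes "((\<lambda>t. f ((x + s *\<^sub>R axis i 1) + t *\<^sub>R axis i 1)) has_vector_derivative D) (at 0)"
  shows "((\<lambda>t. f (x + t *\<^sub>R axis i 1)) has_vector_derivative D) (at s)"
proof -
  have "((\<lambda>t. t - s) has_vector_derivative 1) (at s)"
    by (auto intro!: derivative_eq_intros)
  from vector_diff_chain_at[OF this, of "\<lambda>t. f ((x + s *\<^sub>R axis i 1) + t *\<^sub>R axis i 1)" D] assms
  have "((\<lambda>t. f ((x + s *\<^sub>R axis i 1) + (t - s) *\<^sub>R axis i 1)) has_vector_derivative D) (at s)"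
    by (simp add: o_def)
  then show ?thesis by (simp add: algebra_simps)
qed

lemma C_k_Suc_I:
  assumes "continuous_on S f"
    and "\<And>x i. x \<in> S \<Longrightarrow> ((\<lambda>t. f (x + t *\<^sub>R axis i 1)) has_vector_derivative g i x) (at 0)"
    and "\<And>i. partial_deriv i f \<in> C_k k S"
  shows "f \<in> C_k (Suc k) S"
  using assms by simp (metis differentiableI_vector)

lemma open_line_preimage:
  fixes x e :: "'a::real_normed_vector"
  assumes "open S" shows "open {t::real. x + t *\<^sub>R e \<in> S}"
proof -
  have "open ((\<lambda>t::real. x + t *\<^sub>R e) -` S)"
    using assms by (intro open_vimage continuous_intros) auto
  then show ?thesis by (simp add: vimage_def)
qed

lemma has_partial_cong:
  fixes f g :: "real ^ 'n::finite \<Rightarrow> 'b::real_normed_vector"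
  assumes "open S" "x \<in> S" "\<And>y. y \<in> S \<Longrightarrow> f y = g y"
    and "((\<lambda>t. f (x + t *\<^sub>R axis i 1)) has_vector_derivative D) (at 0)"
  shows "((\<lambda>t. g (x + t *\<^sub>R axis i 1)) has_vector_derivative D) (at 0)"
  by (rule has_vector_derivative_transform_within_open
      [OF assms(4) open_line_preimage[OF assms(1)]]) (use assms in auto)

lemma partial_deriv_cong:
  assumes "open S" "x \<in> S" "\<And>y. y \<in> S \<Longrightarrow> f y = g y"
  shows "partial_deriv i f x = partial_deriv i g x"
proof -
  have "\<And>D. ((\<lambda>t. f (x + t *\<^sub>R axis i 1)) has_vector_derivative D) (at 0) \<longleftrightarrow>
            ((\<lambda>t. g (x + t *\<^sub>R axis i 1)) has_vector_derivative D) (at 0)"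
    using has_partial_cong[OF assms(1,2), of f g] has_partial_cong[OF assms(1,2), of g f] assms(3)
    by metis
  then show ?thesis by (simp add: partial_deriv_def vector_derivative_def)
qed

lemma C_k_cong:
  assumes "open S" "\<And>y. y \<in> S \<Longrightarrow> f y = g y" "f \<in> C_k k S"
  shows "g \<in> C_k k S"
  using assms(2,3)
proof (induction k arbitrary: f g)
  case 0
  then show ?case using continuous_on_cong by fastforce
next
  case (Suc k)
  show ?case
  proof (rule C_k_Suc_I)
    show "continuous_on S g"
      using Suc.prems C_k_continuous_on continuous_on_cong by metis
    show "((\<lambda>t. g (x + t *\<^sub>R axis i 1)) has_vector_derivative partial_deriv i f x) (at 0)"
      if "x \<in> S" for x i
      using has_partial_cong[OF assms(1) that Suc.prems(1) C_k_has_partial[OF Suc.prems(2) that]]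
      by blast
    show "partial_deriv i g \<in> C_k k S" for i
    proof (rule Suc.IH)
      show "partial_deriv i f y = partial_deriv i g y" if "y \<in> S" for y
        by (rule partial_deriv_cong[OF assms(1) that Suc.prems(1)])
    qed (use Suc.prems in auto)
  qed
qed

lemma C_k_mono: "f \<in> C_k (Suc k) S \<Longrightarrow> f \<in> C_k k S"
  by (induction k arbitrary: f) auto

lemma C_k_foldr: "f \<in> C_k (length is + k) S \<Longrightarrow> foldr partial_deriv is f \<in> C_k k S"
  by (induction "is" arbitrary: f rule: rev_induct) auto

lemma C_k_scaleR:
  assumes "open S" "f \<in> C_k k S" shows "(\<lambda>x. c *\<^sub>R f x) \<in> C_k k S"
  using assms(2)
proof (induction k arbitrary: f)
  case 0
  then show ?case by (auto intro: continuous_intros)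
next
  case (Suc k)
  have D: "((\<lambda>t. c *\<^sub>R f (x + t *\<^sub>R axis i 1)) has_vector_derivative c *\<^sub>R partial_deriv i f x) (at 0)"
    if "x \<in> S" for x i
    by (intro has_vector_derivative_scaleR[OF DERIV_const, simplified] C_k_has_partial[OF Suc.prems that]
        derivative_eq_intros refl | simp)+
  show ?case
  proof (rule C_k_Suc_I[OF _ D])
    show "continuous_on S (\<lambda>x. c *\<^sub>R f x)"
      using C_k_continuous_on[OF Suc.prems] by (intro continuous_intros)
    show "partial_deriv i (\<lambda>x. c *\<^sub>R f x) \<in> C_k k S" for i
      by (rule C_k_cong[OF assms(1) _ Suc.IH[of "partial_deriv i f"]])
        (use Suc.prems partial_deriv_eqI[OF D] in auto)
  qed
qed

lemma affine_vimage_open: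
  fixes S :: "'a::real_normed_vector set"
  assumes "open S" shows "open {x. a *\<^sub>R x + b \<in> S}"
proof -
  have "open ((\<lambda>x. a *\<^sub>R x + b) -` S)"
    using assms by (intro open_vimage continuous_intros) auto
  then show ?thesis by (simp add: vimage_def)
qed

lemma has_partial_affine:
  assumes "((\<lambda>t. f ((a *\<^sub>R x + b) + t *\<^sub>R axis i 1)) has_vector_derivative D) (at 0)"
  shows "((\<lambda>t. f (a *\<^sub>R (x + t *\<^sub>R axis i 1) + b)) has_vector_derivative a *\<^sub>R D) (at 0)"
proof -
  have "((\<lambda>t. a * t) has_vector_derivative a) (at 0)"
    by (auto intro!: derivative_eq_intros simp flip: has_real_derivative_iff_has_vector_derivative)
  from vector_diff_chain_at[OF this, of "\<lambda>t. f ((a *\<^sub>R x + b) + t *\<^sub>R axis i 1)" D] assms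
  show ?thesis by (simp add: o_def algebra_simps)
qed

lemma C_k_affine:
  assumes "open S" "f \<in> C_k k S"
  shows "(\<lambda>x. f (a *\<^sub>R x + b)) \<in> C_k k {x. a *\<^sub>R x + b \<in> S}"
  using assms(2)
proof (induction k arbitrary: f)
  case 0
  then show ?case
    by (auto intro!: continuous_intros continuous_on_compose2[of S f])
next
  case (Suc k)
  let ?T = "{x. a *\<^sub>R x + b \<in> S}"
  have D: "((\<lambda>t. f (a *\<^sub>R (x + t *\<^sub>R axis i 1) + b)) has_vector_derivative
            a *\<^sub>R partial_deriv i f (a *\<^sub>R x + b)) (at 0)" if "x \<in> ?T" for x i
    by (rule has_partial_affine, rule C_k_has_partial[OF Suc.prems]) (use that in auto)
  show ?case
  proof (rule C_k_Suc_I[OF _ D])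
    show "continuous_on ?T (\<lambda>x. f (a *\<^sub>R x + b))"
      using C_k_continuous_on[OF Suc.prems]
      by (auto intro!: continuous_intros continuous_on_compose2[of S f])
    show "partial_deriv i (\<lambda>x. f (a *\<^sub>R x + b)) \<in> C_k k ?T" for i
      by (rule C_k_cong[OF affine_vimage_open[OF assms(1)] _
            C_k_scaleR[OF affine_vimage_open[OF assms(1)] Suc.IH[of "partial_deriv i f"]]])
        (use Suc.prems partial_deriv_eqI[OF D] in auto)
  qed
qed

text \<open>
  The factor \<open>a ^ length is\<close> is the source of the concentration: it makes derivatives of rescaled
  test functions grow at the rate at which the homogeneous kernels decay.
\<close>
lemma foldr_partial_affine:
  assumes "open S" "f \<in> C_k (length is) S" "a *\<^sub>R x + b \<in> S"
  shows "foldr partial_deriv is (\<lambda>x. f (a *\<^sub>R x + b)) x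
         = a ^ length is *\<^sub>R foldr partial_deriv is f (a *\<^sub>R x + b)"
  using assms(2,3)
proof (induction "is" arbitrary: x)
  case Nil
  then show ?case by simp
next
  case (Cons i "is")
  let ?T = "{x. a *\<^sub>R x + b \<in> S}" and ?g = "foldr partial_deriv is f"
  have g: "?g \<in> C_k (Suc 0) S" using C_k_foldr[of f "is" "Suc 0" S] Cons.prems by simp
  have IH: "foldr partial_deriv is (\<lambda>x. f (a *\<^sub>R x + b)) y = a ^ length is *\<^sub>R ?g (a *\<^sub>R y + b)"
    if "y \<in> ?T" for y using Cons.IH[of y] Cons.prems C_k_mono[of f "length is" S] that by simp
  have "foldr partial_deriv (i # is) (\<lambda>x. f (a *\<^sub>R x + b)) x =
        partial_deriv i (\<lambda>y. a ^ length is *\<^sub>R ?g (a *\<^sub>R y + b)) x"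
    using partial_deriv_cong[OF affine_vimage_open[OF assms(1)] _ IH] Cons.prems by simp
  also have "\<dots> = a ^ length is *\<^sub>R (a *\<^sub>R partial_deriv i ?g (a *\<^sub>R x + b))"
  proof (rule partial_deriv_eqI)
    show "((\<lambda>t. a ^ length is *\<^sub>R ?g (a *\<^sub>R (x + t *\<^sub>R axis i 1) + b)) has_vector_derivative
        a ^ length is *\<^sub>R (a *\<^sub>R partial_deriv i ?g (a *\<^sub>R x + b))) (at 0)"
      by (rule bounded_linear.has_vector_derivative[OF bounded_linear_scaleR_right],
          rule has_partial_affine, rule C_k_has_partial[OF g Cons.prems(2)])
  qed
  finally show ?case by (simp add: mult.commute)
qed

section \<open>Algebras closed under partial differentiation\<close>

text \<open>
  To see that a concrete function is smooth it suffices to place it in an algebra of functions that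
  is closed under partial differentiation; by the product rule this only has to be checked on generators.
\<close>
inductive_set generated_algebra :: "(real ^ 'n::finite \<Rightarrow> real) set \<Rightarrow> (real ^ 'n \<Rightarrow> real) set"
  for G where
  gen: "g \<in> G \<Longrightarrow> g \<in> generated_algebra G"
| const: "(\<lambda>x. c) \<in> generated_algebra G"
| coord: "(\<lambda>x. x $ i) \<in> generated_algebra G"
| add: "f \<in> generated_algebra G \<Longrightarrow> g \<in> generated_algebra G \<Longrightarrow>
        (\<lambda>x. f x + g x) \<in> generated_algebra G"
| mult: "f \<in> generated_algebra G \<Longrightarrow> g \<in> generated_algebra G \<Longrightarrow>
        (\<lambda>x. f x * g x) \<in> generated_algebra G"

lemma generated_algebra_C_k:
  assumes "open S"
    and cont: "\<And>g. g \<in> G \<Longrightarrow> continuous_on S g"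
    and deriv: "\<And>g i. g \<in> G \<Longrightarrow> \<exists>g'\<in>generated_algebra G. \<forall>x\<in>S.
          ((\<lambda>t. g (x + t *\<^sub>R axis i 1)) has_real_derivative g' x) (at 0)"
    and "f \<in> generated_algebra G"
  shows "f \<in> C_k k S"
proof -
  have ex: "\<exists>f'\<in>generated_algebra G. \<forall>x\<in>S.
          ((\<lambda>t. f (x + t *\<^sub>R axis i 1)) has_real_derivative f' x) (at 0)"
    if "f \<in> generated_algebra G" for f i
    using that
  proof induction
    case (gen g)
    then show ?case using deriv by blast
  next
    case (const c)
    show ?case by (rule bexI[OF _ generated_algebra.const[of 0]]) auto
  next
    case (coord j)
    show ?case
      by (rule bexI[OF _ generated_algebra.const[of "axis i 1 $ j"]])
        (auto intro!: derivative_eq_intros)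
  next
    case (add f g)
    then obtain f' g' where
      "f' \<in> generated_algebra G" "g' \<in> generated_algebra G"
      and D: "\<forall>x\<in>S. ((\<lambda>t. f (x + t *\<^sub>R axis i 1)) has_real_derivative f' x) (at 0)"
      "\<forall>x\<in>S. ((\<lambda>t. g (x + t *\<^sub>R axis i 1)) has_real_derivative g' x) (at 0)"
      by blast
    then have "(\<lambda>x. f' x + g' x) \<in> generated_algebra G" by (intro generated_algebra.add)
    then show ?case by (rule rev_bexI) (use D in \<open>auto intro!: derivative_eq_intros\<close>)
  next
    case (mult f g)
    then obtain f' g' where
      "f' \<in> generated_algebra G" "g' \<in> generated_algebra G"
      and D: "\<forall>x\<in>S. ((\<lambda>t. f (x + t *\<^sub>R axis i 1)) has_real_derivative f' x) (at 0)"
      "\<forall>x\<in>S. ((\<lambda>t. g (x + t *\<^sub>R axis i 1)) has_real_derivative g' x) (at 0)"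
      by blast
    then have "(\<lambda>x. f' x * g x + g' x * f x) \<in> generated_algebra G"
      using mult.hyps by (intro generated_algebra.add generated_algebra.mult)
    moreover have "((\<lambda>t. f (x + t *\<^sub>R axis i 1) * g (x + t *\<^sub>R axis i 1)) has_real_derivative
        f' x * g x + g' x * f x) (at 0)" if "x \<in> S" for x
      using DERIV_mult[OF bspec[OF D(1) that] bspec[OF D(2) that]] by simp
    ultimately show ?case by (rule_tac rev_bexI) auto
  qed
  have cont: "continuous_on S f" if "f \<in> generated_algebra G" for f
    using that
  proof induction
    case (gen g)
    then show ?case by (rule cont)
  qed (auto intro!: continuous_intros)
  show ?thesis
    using assms(4)
  proof (induction k arbitrary: f)
    case 0
    then show ?case using cont by simp
  next
    case (Suc k)
    obtain f' where f': "\<And>i. f' i \<in> generated_algebra G"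
      "\<And>i x. x \<in> S \<Longrightarrow>
        ((\<lambda>t. f (x + t *\<^sub>R axis i 1)) has_vector_derivative f' i x) (at 0)"
      using ex[OF Suc.prems] unfolding has_real_derivative_iff_has_vector_derivative by metis
    show ?case
    proof (rule C_k_Suc_I[OF cont[OF Suc.prems] f'(2)])
      show "partial_deriv i f \<in> C_k k S" for i
        by (rule C_k_cong[OF \<open>open S\<close> _ Suc.IH[OF f'(1)[of i]]])
          (use partial_deriv_eqI[OF f'(2)] in auto)
    qed
  qed
qed

lemma has_partial_componentwise:
  fixes f :: "real ^ 'n::finite \<Rightarrow> real ^ 'm::finite"
  assumes "\<And>j. ((\<lambda>t. f (x + t *\<^sub>R axis i 1) $ j) has_vector_derivative D $ j) (at 0)"
  shows "((\<lambda>t. f (x + t *\<^sub>R axis i 1)) has_vector_derivative D) (at 0)"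
  unfolding has_vector_derivative_def
  by (subst has_derivative_componentwise_within)
    (use assms in \<open>auto simp: has_vector_derivative_def Basis_vec_def inner_axis\<close>)

lemma C_k_componentwise:
  fixes f :: "real ^ 'n::finite \<Rightarrow> real ^ 'm::finite"
  assumes "open S" "\<And>j. (\<lambda>x. f x $ j) \<in> C_k k S"
  shows "f \<in> C_k k S"
  using assms(2)
proof (induction k arbitrary: f)
  case 0
  then have "continuous_on S (\<lambda>x. \<chi> j. f x $ j)"
    by (intro continuous_on_vec_lambda) auto
  then show ?case by simp
next
  case (Suc k)
  have D: "((\<lambda>t. f (x + t *\<^sub>R axis i 1)) has_vector_derivative
      (\<chi> j. partial_deriv i (\<lambda>x. f x $ j) x)) (at 0)" if "x \<in> S" for x i
    by (rule has_partial_componentwise) (use C_k_has_partial[OF Suc.prems that] in simp)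
  have "continuous_on S (\<lambda>x. \<chi> j. f x $ j)"
    by (intro continuous_on_vec_lambda C_k_continuous_on[where k = "Suc k"] Suc.prems)
  then have "continuous_on S f" by simp
  then show ?case
  proof (rule C_k_Suc_I[OF _ D])
    show "partial_deriv i f \<in> C_k k S" for i
    proof (rule Suc.IH)
      fix j
      show "(\<lambda>x. partial_deriv i f x $ j) \<in> C_k k S"
        by (rule C_k_cong[OF \<open>open S\<close>, of "partial_deriv i (\<lambda>x. f x $ j)"])
          (use Suc.prems[of j] partial_deriv_eqI[OF D] in auto)
    qed
  qed
qed

section \<open>A smooth bump function\<close>

text \<open>
  Derivatives of \<open>exp (- (1 / t))\<close>, extended by \<open>0\<close> to the left, are polynomials in \<open>1 / t\<close> times
  \<open>exp (- (1 / t))\<close>; keeping the polynomial as a parameter gives a family closed under differentiation.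
\<close>
definition flat_exp :: "real poly \<Rightarrow> real \<Rightarrow> real" where
  "flat_exp p t = (if 0 < t then poly p (1 / t) * exp (- (1 / t)) else 0)"

lemma tendsto_poly_div_exp: "((\<lambda>u::real. poly p u * exp (- u)) \<longlongrightarrow> 0) at_top"
proof -
  have "((\<lambda>u::real. \<Sum>i\<le>degree p. coeff p i * (u ^ i / exp u)) \<longlongrightarrow> 0) at_top"
    by (intro tendsto_null_sum tendsto_mult_right_zero tendsto_power_div_exp_0)
  then show ?thesis
    by (simp add: poly_altdef sum_distrib_right exp_minus divide_inverse mult.assoc)
qed

lemma flat_exp_tendsto_0: "(flat_exp p \<longlongrightarrow> 0) (at 0)"
proof (rule filterlim_split_at)
  have "eventually (\<lambda>t. flat_exp p t = 0) (at_left 0)"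
    by (auto simp: eventually_at_filter flat_exp_def)
  then show "(flat_exp p \<longlongrightarrow> 0) (at_left 0)" by (rule tendsto_eventually)
next
  have "((\<lambda>t. poly p (inverse t) * exp (- inverse t)) \<longlongrightarrow> 0) (at_right 0)"
    by (rule filterlim_compose[OF tendsto_poly_div_exp filterlim_inverse_at_top_right])
  then show "(flat_exp p \<longlongrightarrow> 0) (at_right 0)"
  proof (rule Lim_transform_eventually)
    show "\<forall>\<^sub>F x in at_right 0. poly p (inverse x) * exp (- inverse x) = flat_exp p x"
      by (auto simp: eventually_at_filter flat_exp_def inverse_eq_divide)
  qed
qed

lemma flat_exp_deriv:
  "(flat_exp p has_real_derivative flat_exp (pCons 0 (pCons 0 (p - pderiv p))) t) (at t)"
proof (cases t "0::real" rule: linorder_cases)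
  case less
  have "(flat_exp p has_real_derivative 0) (at t)"
    by (rule has_field_derivative_transform_within_open[OF DERIV_const, where S = "{..<0}"])
      (use less in \<open>auto simp: flat_exp_def\<close>)
  then show ?thesis using less by (simp add: flat_exp_def)
next
  case equal
  have "((\<lambda>h. (flat_exp p (0 + h) - flat_exp p 0) / h) \<longlongrightarrow> 0) (at 0)"
  proof (rule Lim_transform_eventually[OF flat_exp_tendsto_0[of "pCons 0 p"]])
    show "\<forall>\<^sub>F h in at 0. flat_exp (pCons 0 p) h = (flat_exp p (0 + h) - flat_exp p 0) / h"
      by (auto simp: eventually_at_filter flat_exp_def)
  qed
  then show ?thesis using equal by (simp add: DERIV_def flat_exp_def)
next
  case greater
  let ?D = "flat_exp (pCons 0 (pCons 0 (p - pderiv p))) t"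
  have "((\<lambda>t. poly p (1 / t) * exp (- (1 / t))) has_real_derivative ?D) (at t)"
  proof -
    have i: "((\<lambda>t. 1 / t) has_real_derivative - ((1 / t) * (1 / t))) (at t)"
      using DERIV_inverse[of t] greater by (simp add: inverse_eq_divide power2_eq_square)
    show ?thesis
      by (rule DERIV_cong[OF DERIV_mult[OF DERIV_chain2[OF poly_DERIV i]
              DERIV_chain2[OF DERIV_exp DERIV_minus[OF i]]]])
        (use greater in \<open>simp add: flat_exp_def, simp add: field_simps\<close>)
  qed
  then show ?thesis
    by (rule has_field_derivative_transform_within_open[where S = "{0<..}"])
      (use greater in \<open>auto simp: flat_exp_def\<close>)
qed

definition bump :: "real ^ 'n::finite \<Rightarrow> real" where
  "bump x = flat_exp 1 (1 - x \<bullet> x)"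

lemma has_partial_inner_self:
  fixes x :: "real ^ 'n::finite"
  shows "((\<lambda>t. (x + t *\<^sub>R axis i 1) \<bullet> (x + t *\<^sub>R axis i 1)) has_real_derivative 2 * x $ i) (at 0)"
proof -
  have "(x + t *\<^sub>R axis i 1) \<bullet> (x + t *\<^sub>R axis i 1) = x \<bullet> x + 2 * t * x $ i + t ^ 2" for t
    by (simp add: inner_add_left inner_add_right inner_axis inner_axis' inner_axis_axis
        power2_eq_square algebra_simps)
  moreover have "((\<lambda>t. x \<bullet> x + 2 * t * x $ i + t ^ 2) has_real_derivative 2 * x $ i) (at 0)"
    by (auto intro!: derivative_eq_intros)
  ultimately show ?thesis by simp
qed

text \<open>
  The generators are all \<open>flat_exp p\<close> composed with \<open>1 - x \<bullet> x\<close>: differentiation changes the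
  polynomial \<open>p\<close> and produces a coordinate as a factor.
\<close>
lemma bump_C_k: "(bump :: real ^ 'n::finite \<Rightarrow> real) \<in> C_k k UNIV"
proof (rule generated_algebra_C_k)
  let ?G = "range (\<lambda>p (x :: real ^ 'n). flat_exp p (1 - x \<bullet> x))"
  show "bump \<in> generated_algebra ?G"
    by (rule generated_algebra.gen) (auto simp: bump_def[abs_def])
  show "continuous_on UNIV g" if "g \<in> ?G" for g
  proof -
    have "continuous_on UNIV (flat_exp p)" for p
      using flat_exp_deriv by (intro DERIV_continuous_on) (auto intro: has_field_derivative_at_within)
    then have "continuous_on UNIV (\<lambda>x :: real ^ 'n. flat_exp p (1 - x \<bullet> x))" for p
      by (rule continuous_on_compose2) (auto intro!: continuous_intros)
    then show ?thesis using that by auto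
  qed
  show "\<exists>g'\<in>generated_algebra ?G. \<forall>x\<in>UNIV.
      ((\<lambda>t. g (x + t *\<^sub>R axis i 1)) has_real_derivative g' x) (at 0)" if "g \<in> ?G" for g i
  proof -
    from that obtain p where g: "g = (\<lambda>x. flat_exp p (1 - x \<bullet> x))" by (rule rangeE)
    let ?q = "pCons 0 (pCons 0 (p - pderiv p))"
    let ?g' = "\<lambda>x :: real ^ 'n. flat_exp ?q (1 - x \<bullet> x) * (- 2 * x $ i)"
    have "?g' \<in> generated_algebra ?G"
      by (intro generated_algebra.mult generated_algebra.const generated_algebra.coord
          generated_algebra.gen) auto
    moreover have "((\<lambda>t. g (x + t *\<^sub>R axis i 1)) has_real_derivative ?g' x) (at 0)" for x
    proof -
      have "((\<lambda>t. 1 - (x + t *\<^sub>R axis i 1) \<bullet> (x + t *\<^sub>R axis i 1)) has_real_derivative - 2 * x $ i)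
          (at 0)"
        using DERIV_diff[OF DERIV_const has_partial_inner_self[of x i], of 1] by simp
      from DERIV_chain2[OF flat_exp_deriv this] show ?thesis unfolding g by simp
    qed
    ultimately show ?thesis by (rule_tac rev_bexI) auto
  qed
qed auto

lemma bump_nonneg: "bump x \<ge> 0"
  by (simp add: bump_def flat_exp_def)

lemma bump_pos_iff: "bump x \<noteq> 0 \<longleftrightarrow> norm x < 1"
  using power_less_one_iff[of "norm x" 2] by (auto simp: bump_def flat_exp_def power2_norm_eq_inner)

section \<open>The kernel and its homogeneous derivatives\<close>

definition sign_kernel :: "real ^ 'n::finite \<Rightarrow> real ^ 'n" where
  "sign_kernel x = x /\<^sub>R norm x"

lemma inverse_norm_partial:
  fixes x :: "real ^ 'n::finite"
  assumes "x \<noteq> 0"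
  shows "((\<lambda>t. inverse (norm (x + t *\<^sub>R axis i 1))) has_real_derivative
      - x $ i * inverse (norm x) ^ 3) (at 0)"
proof -
  let ?s = "\<lambda>t. (x + t *\<^sub>R axis i 1) \<bullet> (x + t *\<^sub>R axis i 1)"
  have pos: "0 < x \<bullet> x" using assms by simp
  have sq: "inverse (sqrt (x \<bullet> x)) * inverse (sqrt (x \<bullet> x)) = inverse (x \<bullet> x)"
    by (simp flip: inverse_mult_distrib)
  have D: "((\<lambda>t. sqrt (?s t)) has_real_derivative inverse (sqrt (x \<bullet> x)) / 2 * (2 * x $ i)) (at 0)"
    by (rule DERIV_chain2[OF _ has_partial_inner_self]) (use DERIV_real_sqrt[OF pos] in simp)
  have "((\<lambda>t. inverse (sqrt (?s t))) has_real_derivative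
      - x $ i * inverse (sqrt (x \<bullet> x)) ^ 3) (at 0)"
    by (rule DERIV_cong[OF DERIV_inverse_fun[OF D]])
      (use sq assms in \<open>simp_all add: power3_eq_cube\<close>)
  then show ?thesis by (simp add: norm_eq_sqrt_inner)
qed

text \<open>
  One generator suffices, since the derivative of \<open>1 / norm x\<close> in direction \<open>i\<close> is
  \<open>- x $ i * (1 / norm x) ^ 3\<close>.
\<close>
lemma sign_kernel_C_k: "sign_kernel \<in> C_k k (- {0 :: real ^ 'n::finite})"
proof (rule C_k_componentwise)
  fix j :: 'n
  let ?G = "{\<lambda>x :: real ^ 'n. inverse (norm x)}"
  show "(\<lambda>x :: real ^ 'n. sign_kernel x $ j) \<in> C_k k (- {0})"
  proof (rule generated_algebra_C_k)
    show "(\<lambda>x :: real ^ 'n. sign_kernel x $ j) \<in> generated_algebra ?G"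
      unfolding sign_kernel_def
      by (simp, intro generated_algebra.mult generated_algebra.coord generated_algebra.gen) auto
    show "continuous_on (- {0}) g" if "g \<in> ?G" for g
      using that by (auto intro!: continuous_intros)
    show "\<exists>g'\<in>generated_algebra ?G. \<forall>x\<in>- {0}.
        ((\<lambda>t. g (x + t *\<^sub>R axis i 1)) has_real_derivative g' x) (at 0)" if "g \<in> ?G" for g i
    proof (intro bexI ballI)
      let ?r = "\<lambda>x :: real ^ 'n. inverse (norm x)"
      show "(\<lambda>x. ((-1) * x $ i) * (?r x * (?r x * ?r x))) \<in> generated_algebra ?G"
        by (intro generated_algebra.mult generated_algebra.const generated_algebra.coord
            generated_algebra.gen) auto
      show "((\<lambda>t. g (x + t *\<^sub>R axis i 1)) has_real_derivative
          ((-1) * x $ i) * (?r x * (?r x * ?r x))) (at 0)" if "x \<in> - {0}" for x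
        using inverse_norm_partial[of x i] that \<open>g \<in> ?G\<close>
        by (simp add: power3_eq_cube mult.assoc)
    qed
  qed auto
qed auto

text \<open>
  The origin is excluded because \<open>partial_deriv\<close> returns an arbitrary value at a singularity.
\<close>
definition smooth_homogeneous :: "nat \<Rightarrow> (real ^ 'n::finite \<Rightarrow> 'b::real_normed_vector) \<Rightarrow> bool" where
  "smooth_homogeneous m G \<longleftrightarrow> (\<forall>k. G \<in> C_k k (- {0})) \<and>
     (\<forall>t>0. \<forall>x. x \<noteq> 0 \<longrightarrow> G (t *\<^sub>R x) = inverse t ^ m *\<^sub>R G x)"

declare C_k.simps [simp del]

lemma smooth_homogeneous_C_k: "smooth_homogeneous m G \<Longrightarrow> G \<in> C_k k (- {0})"
  by (simp add: smooth_homogeneous_def)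

lemma smooth_homogeneous_continuous: "smooth_homogeneous m G \<Longrightarrow> continuous_on (- {0}) G"
  by (rule C_k_continuous_on, rule smooth_homogeneous_C_k)

lemma smooth_homogeneous_sign_kernel: "smooth_homogeneous 0 (sign_kernel :: real ^ 'n::finite \<Rightarrow> _)"
  by (auto simp: smooth_homogeneous_def sign_kernel_C_k) (auto simp: sign_kernel_def)

lemma smooth_homogeneous_partial:
  fixes G :: "real ^ 'n::finite \<Rightarrow> 'b::real_normed_vector"
  assumes "smooth_homogeneous m G"
  shows "smooth_homogeneous (Suc m) (partial_deriv i G)"
  unfolding smooth_homogeneous_def
proof (intro conjI allI impI)
  have Ck: "G \<in> C_k k (- {0})" for k using assms by (simp add: smooth_homogeneous_def)
  show "partial_deriv i G \<in> C_k k (- {0})" for k using Ck[of "Suc k"] by (simp add: C_k.simps)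
  fix t :: real and x :: "real ^ 'n"
  assume t: "0 < t" and x: "x \<noteq> 0"
  have "((\<lambda>s. G (t *\<^sub>R (x + s *\<^sub>R axis i 1) + 0)) has_vector_derivative
      t *\<^sub>R partial_deriv i G (t *\<^sub>R x + 0)) (at 0)"
    by (rule has_partial_affine, rule C_k_has_partial[OF Ck]) (use t x in auto)
  then have "partial_deriv i (\<lambda>y. G (t *\<^sub>R y)) x = t *\<^sub>R partial_deriv i G (t *\<^sub>R x)"
    by (intro partial_deriv_eqI) simp
  moreover have "partial_deriv i (\<lambda>y. G (t *\<^sub>R y)) x = partial_deriv i (\<lambda>y. inverse t ^ m *\<^sub>R G y) x"
    by (rule partial_deriv_cong[of "- {0}"])
      (use assms t x in \<open>auto simp: smooth_homogeneous_def\<close>)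
  moreover have "partial_deriv i (\<lambda>y. inverse t ^ m *\<^sub>R G y) x = inverse t ^ m *\<^sub>R partial_deriv i G x"
    by (rule partial_deriv_eqI,
        rule bounded_linear.has_vector_derivative[OF bounded_linear_scaleR_right],
        rule C_k_has_partial[OF Ck]) (use x in auto)
  ultimately have "t *\<^sub>R partial_deriv i G (t *\<^sub>R x) = inverse t ^ m *\<^sub>R partial_deriv i G x"
    by simp
  then have "inverse t *\<^sub>R (t *\<^sub>R partial_deriv i G (t *\<^sub>R x))
      = inverse t *\<^sub>R (inverse t ^ m *\<^sub>R partial_deriv i G x)" by simp
  then show "partial_deriv i G (t *\<^sub>R x) = inverse t ^ Suc m *\<^sub>R partial_deriv i G x"
    using t by simp
qed

lemma smooth_homogeneous_foldr:
  "smooth_homogeneous m G \<Longrightarrow> smooth_homogeneous (length is + m) (foldr partial_deriv is G)"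
  by (induction "is") (auto intro: smooth_homogeneous_partial)

text \<open>
  A homogeneous function is determined by its values on the unit sphere, where it is bounded by
  compactness.
\<close>
lemma smooth_homogeneous_bound:
  fixes G :: "real ^ 'n::finite \<Rightarrow> 'b::real_normed_vector"
  assumes "smooth_homogeneous m G"
  obtains C where "C > 0" "\<And>x. x \<noteq> 0 \<Longrightarrow> norm (G x) \<le> C * inverse (norm x) ^ m"
proof -
  have "continuous_on (- {0}) G"
    by (rule smooth_homogeneous_continuous[OF assms])
  then have "compact (G ` sphere 0 1)"
    by (intro compact_continuous_image) (auto intro: continuous_on_subset)
  then obtain C where C: "C > 0" "\<And>x. x \<in> sphere 0 1 \<Longrightarrow> norm (G x) \<le> C"
    using compact_imp_bounded bounded_pos by (metis imageI)
  show ?thesis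
  proof (rule that[OF C(1)])
    fix x :: "real ^ 'n" assume x: "x \<noteq> 0"
    have "G (norm x *\<^sub>R (x /\<^sub>R norm x)) = inverse (norm x) ^ m *\<^sub>R G (x /\<^sub>R norm x)"
      using assms x unfolding smooth_homogeneous_def by (metis inverse_nonzero_iff_nonzero
          norm_eq_zero scaleR_eq_0_iff zero_less_norm_iff)
    then have "norm (G x) = inverse (norm x) ^ m * norm (G (x /\<^sub>R norm x))" using x by simp
    also have "\<dots> \<le> inverse (norm x) ^ m * C"
      by (intro mult_left_mono C) (use x in auto)
    finally show "norm (G x) \<le> C * inverse (norm x) ^ m" by (simp add: mult.commute)
  qed
qed

text \<open>
  A line in direction \<open>i\<close> through a point with a nonzero coordinate \<open>j \<noteq> i\<close> misses the
  singularity, so a vanishing partial derivative forces constancy along the whole line.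
\<close>
lemma line_constant:
  fixes G :: "real ^ 'n::finite \<Rightarrow> 'b::real_normed_vector"
  assumes Ck: "G \<in> C_k 1 (- {0})"
    and zero: "\<And>y. y \<noteq> 0 \<Longrightarrow> partial_deriv i G y = 0"
    and x: "x $ j \<noteq> 0" "j \<noteq> i"
  shows "G (x + t *\<^sub>R axis i 1) = G x"
proof -
  have ne: "x + s *\<^sub>R axis i 1 \<noteq> 0" for s
    using x by (auto simp: vec_eq_iff axis_def intro!: exI[of _ j])
  have "((\<lambda>t. G (x + t *\<^sub>R axis i 1)) has_vector_derivative 0) (at s)" for s
    using has_partial_shift[where f = G, OF C_k_has_partial[of G 0 "- {0}"]] Ck zero[OF ne] ne
    by (metis Compl_iff One_nat_def singletonD)
  then obtain c where "\<And>s. G (x + s *\<^sub>R axis i 1) = c"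
    using has_vector_derivative_zero_constant[of UNIV "\<lambda>t. G (x + t *\<^sub>R axis i 1)"] by auto
  from this[of t] this[of 0] show ?thesis by simp
qed

text \<open>
  The explicit derivatives are unwieldy, but their vanishing would be too rigid. If \<open>\<partial>\<^sub>i G\<close>
  vanishes off the origin, then \<open>G\<close> is constant on lines in direction \<open>i\<close>. When \<open>G\<close> is
  homogeneous of negative degree it tends to \<open>0\<close> along each such line and hence vanishes off a
  hyperplane, which by continuity contradicts the induction hypothesis; when \<open>G\<close> is the kernel
  itself, its \<open>i\<close>-th component is visibly not constant on such a line.
\<close>
lemma iterated_partial_sign_kernel_nonzero:
  assumes "CARD('n::finite) \<ge> 2"
  shows "\<exists>x :: real ^ 'n. x \<noteq> 0 \<and> foldr partial_deriv is sign_kernel x \<noteq> 0"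
proof (induction "is")
  case Nil
  show ?case
    by (rule exI[of _ "axis undefined 1"]) (simp add: sign_kernel_def)
next
  case (Cons i "is")
  define G :: "real ^ 'n \<Rightarrow> real ^ 'n" where "G = foldr partial_deriv is sign_kernel"
  have hom: "smooth_homogeneous (length is) G"
    using smooth_homogeneous_foldr[OF smooth_homogeneous_sign_kernel] by (simp add: G_def)
  obtain j where j: "j \<noteq> i"
    using assms card_2_iff' ex_card[of 2 "UNIV :: 'n set"] by (metis UNIV_I)
  show ?case
  proof (rule ccontr)
    assume "\<not> ?thesis"
    then have zero: "\<And>y. y \<noteq> 0 \<Longrightarrow> partial_deriv i G y = 0" by (auto simp: G_def)
    have const: "G (x + t *\<^sub>R axis i 1) = G x" if "x $ j \<noteq> 0" for x t
      by (rule line_constant[OF smooth_homogeneous_C_k[OF hom] zero that j])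
    show False
    proof (cases "is")
      case Nil
      have "G (axis j 1 + 1 *\<^sub>R axis i 1) $ i = G (axis j 1) $ i"
        by (subst const) auto
      then have "axis j 1 + axis i 1 = (0 :: real ^ 'n)"
        using j by (simp add: Nil G_def sign_kernel_def axis_def)
      then have "(axis j 1 + axis i 1 :: real ^ 'n) $ i = 0" by simp
      then show False using j by (simp add: axis_def)
    next
      case (Cons i' is')
      let ?U = "{x \<in> - {0}. G x \<in> - {0}}"
      have "continuous_on (- {0}) G"
        by (rule smooth_homogeneous_continuous[OF hom])
      then have "open ?U"
        using continuous_open_preimage[of "- {0}" G "- {0}"]
        by (simp add: vimage_def Int_def open_Compl)
      have "\<not> ?U \<subseteq> {x. axis j 1 \<bullet> x = 0}"
      proof
        assume "?U \<subseteq> {x. axis j 1 \<bullet> x = 0}"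
        then have "?U \<subseteq> interior {x. axis j 1 \<bullet> x = 0}"
          by (rule interior_maximal) fact
        also have "\<dots> = {}" by (rule interior_hyperplane) simp
        finally show False using Cons.IH unfolding G_def by auto
      qed
      then obtain x where x: "x $ j \<noteq> 0" "G x \<noteq> 0" by (auto simp: inner_axis')
      obtain C where C: "C > 0" "\<And>x. x \<noteq> 0 \<Longrightarrow> norm (G x) \<le> C * inverse (norm x) ^ length is"
        using smooth_homogeneous_bound[OF hom] by metis
      \<comment> \<open>Far enough out for the decay estimate to push \<open>norm (G ?y)\<close> below \<open>norm (G x)\<close>.\<close>
      define t where "t = norm x + 1 + C / norm (G x)"
      let ?y = "x + t *\<^sub>R axis i 1"
      have "norm (t *\<^sub>R axis i 1 :: real ^ 'n) = t" using C(1) by (simp add: t_def)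
      then have ny: "norm ?y \<ge> 1 + C / norm (G x)"
        using norm_triangle_ineq2[of "t *\<^sub>R axis i 1" "- x"] by (simp add: t_def add.commute)
      have C': "0 \<le> C / norm (G x)" using C(1) by simp
      then have y1: "norm ?y \<ge> 1" using ny by linarith
      then have "?y \<noteq> 0" by auto
      have "norm (G x) = norm (G ?y)" using const[OF x(1)] by simp
      also have "\<dots> \<le> C * inverse (norm ?y) ^ length is" by (rule C(2)) fact
      also have "\<dots> \<le> C * inverse (norm ?y) ^ 1"
        using C(1) y1 Cons by (intro mult_left_mono power_decreasing) (auto intro: inverse_le_1_iff[THEN iffD2])
      finally have "norm (G x) \<le> C / norm ?y" by (simp add: divide_inverse)
      then have "norm (G x) * norm ?y \<le> C"
        by (subst (asm) pos_le_divide_eq) (use y1 in linarith)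
      moreover have "norm (G x) * norm ?y \<ge> norm (G x) * (1 + C / norm (G x))"
        by (intro mult_left_mono ny) auto
      moreover have "norm (G x) * (1 + C / norm (G x)) = norm (G x) + C"
        using x(2) by (simp add: field_simps)
      moreover have "0 < norm (G x)" using x(2) by simp
      ultimately show False by linarith
    qed
  qed
qed

section \<open>Integration by parts\<close>

lemma integral_affine:
  fixes f :: "'a::euclidean_space \<Rightarrow> 'b::{banach, second_countable_topology}"
  assumes "c \<noteq> 0" and [measurable]: "f \<in> borel_measurable borel"
  shows "(\<integral>x. f x \<partial>lborel) = \<bar>c\<bar> ^ DIM('a) *\<^sub>R (\<integral>x. f (c *\<^sub>R x + b) \<partial>lborel)"
proof -
  have "(\<integral>x. f x \<partial>lborel) =
      integral\<^sup>L (density (distr lborel borel (\<lambda>x. b + c *\<^sub>R x)) (\<lambda>_. ennreal (\<bar>c\<bar> ^ DIM('a)))) f"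
    using lborel_affine[OF assms(1), of b] by (simp add: ennreal_power)
  also have "\<dots> = \<bar>c\<bar> ^ DIM('a) *\<^sub>R (\<integral>x. f (c *\<^sub>R x + b) \<partial>lborel)"
    by (subst integral_density) (auto simp: integral_distr add.commute)
  finally show ?thesis .
qed

lemma integrable_affine:
  fixes f :: "'a::euclidean_space \<Rightarrow> 'b::{banach, second_countable_topology}"
  assumes "c \<noteq> 0" "integrable lborel f"
  shows "integrable lborel (\<lambda>x. f (c *\<^sub>R x + b))"
proof -
  have [measurable]: "f \<in> borel_measurable borel" using assms(2) by auto
  have "integrable (density (distr lborel borel (\<lambda>x. b + c *\<^sub>R x)) (\<lambda>_. ennreal (\<bar>c\<bar> ^ DIM('a)))) f"
    using assms(2) lborel_affine[OF assms(1), of b] by (simp add: ennreal_power)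
  then have "integrable lborel (\<lambda>x. \<bar>c\<bar> ^ DIM('a) *\<^sub>R f (b + c *\<^sub>R x))"
    by (subst (asm) integrable_density) (auto simp: integrable_distr_eq)
  then have "integrable lborel (\<lambda>x. inverse (\<bar>c\<bar> ^ DIM('a)) *\<^sub>R \<bar>c\<bar> ^ DIM('a) *\<^sub>R f (b + c *\<^sub>R x))"
    by (rule integrable_scaleR_right)
  then show ?thesis using assms(1) by (simp add: add.commute)
qed

lemma compactly_supported_integrable:
  fixes f :: "'a::euclidean_space \<Rightarrow> 'b::euclidean_space"
  assumes "continuous_on UNIV f" "\<And>x. f x \<noteq> 0 \<Longrightarrow> norm x \<le> R"
  shows "integrable lborel f"
proof -
  have "set_integrable lborel (cball 0 R) f"
    unfolding set_integrable_def
    by (rule borel_integrable_compact) (use assms in \<open>auto intro: continuous_on_subset\<close>)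
  moreover have "(\<lambda>x. indicator (cball 0 R) x *\<^sub>R f x) = f"
    using assms(2) by (auto simp: indicator_def fun_eq_iff)
  ultimately show ?thesis by (simp add: set_integrable_def)
qed

lemma compactly_supported_bounded:
  fixes f :: "'a::euclidean_space \<Rightarrow> 'b::real_normed_vector"
  assumes "continuous_on UNIV f" "\<And>x. f x \<noteq> 0 \<Longrightarrow> norm x \<le> R"
  obtains B where "B > 0" "\<And>x. norm (f x) \<le> B"
proof -
  have "compact (f ` cball 0 R)"
    using assms(1) by (intro compact_continuous_image) (auto intro: continuous_on_subset)
  then obtain B where B: "B > 0" "\<And>x. x \<in> cball 0 R \<Longrightarrow> norm (f x) \<le> B"
    using compact_imp_bounded bounded_pos by (metis imageI)
  have "norm (f x) \<le> B" for x
    using B(2)[of x] B(1) assms(2)[of x] by (cases "f x = 0") auto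
  then show ?thesis using that B(1) by blast
qed

text \<open>
  The difference quotients of \<open>u\<close> in direction \<open>i\<close> have integral \<open>0\<close> by translation invariance,
  and they converge boundedly, with uniformly bounded supports, to \<open>w\<close>.
\<close>
lemma integral_partial_zero:
  fixes u :: "real ^ 'n::finite \<Rightarrow> 'b::euclidean_space"
  assumes cont: "continuous_on UNIV u" "continuous_on UNIV w"
    and supp: "\<And>x. u x \<noteq> 0 \<Longrightarrow> norm x \<le> R"
    and deriv: "\<And>x. ((\<lambda>t. u (x + t *\<^sub>R axis i 1)) has_vector_derivative w x) (at 0)"
  shows "integral\<^sup>L lborel w = 0"
proof -
  let ?e = "axis i 1 :: real ^ 'n"
  have suppw: "norm x \<le> R" if "w x \<noteq> 0" for x
  proof (rule ccontr)
    assume "\<not> norm x \<le> R"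
    then have x: "x \<in> - cball 0 R" by simp
    have "((\<lambda>t. 0) has_vector_derivative w x) (at (0::real))"
      by (rule has_partial_cong[OF _ x _ deriv[of x], where g = "\<lambda>_. 0", simplified])
        (use supp in auto)
    then have "w x = 0"
      using vector_derivative_at by fastforce
    then show False using that by simp
  qed
  obtain B where B: "B > 0" "\<And>x. norm (w x) \<le> B"
    using compactly_supported_bounded[OF cont(2) suppw] by blast
  have int: "integrable lborel u" by (rule compactly_supported_integrable[OF cont(1) supp])
  have [measurable]: "u \<in> borel_measurable borel" "w \<in> borel_measurable borel"
    using cont by (auto intro: borel_measurable_continuous_onI)
  have int': "integrable lborel (\<lambda>x. u (x + b))" for b
    using integrable_affine[of 1 u b] int by simp
  have lip: "norm (u (x + t *\<^sub>R ?e) - u x) \<le> B * \<bar>t\<bar>" for x t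
  proof -
    have D: "((\<lambda>t. u (x + t *\<^sub>R ?e)) has_vector_derivative w (x + s *\<^sub>R ?e)) (at s)" for s
      by (rule has_partial_shift, rule deriv)
    have "norm (u (x + t *\<^sub>R ?e) - u (x + 0 *\<^sub>R ?e)) \<le> B * norm (t - 0)"
    proof (rule differentiable_bound[of UNIV])
      show "((\<lambda>t. u (x + t *\<^sub>R ?e)) has_derivative (\<lambda>h. h *\<^sub>R w (x + s *\<^sub>R ?e))) (at s within UNIV)"
        for s using D by (simp add: has_vector_derivative_def)
      show "onorm (\<lambda>h. h *\<^sub>R w (x + s *\<^sub>R ?e)) \<le> B" for s
        by (rule onorm_le) (simp add: mult_right_mono mult.commute[of B] mult_left_mono B)
    qed auto
    then show ?thesis by simp
  qed
  define v where "v n x = real (Suc n) *\<^sub>R (u (x + inverse (real (Suc n)) *\<^sub>R ?e) - u x)" for n x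
  have "(\<lambda>n. integral\<^sup>L lborel (v n)) \<longlonglongrightarrow> integral\<^sup>L lborel w"
  proof (rule integral_dominated_convergence)
    show "integrable lborel (\<lambda>x :: real ^ 'n. B * indicator (cball 0 (R + 1)) x :: real)"
      by (intro integrable_mult_right integrable_real_indicator)
        (use emeasure_lborel_cball_finite[of "0 :: real ^ 'n" "R + 1"] in auto)
    show "AE x in lborel. (\<lambda>n. v n x) \<longlonglongrightarrow> w x"
    proof (rule AE_I2)
      fix x
      have "((\<lambda>h. (u (x + h *\<^sub>R ?e) - u x) /\<^sub>R h) \<longlongrightarrow> w x) (at 0)"
      proof -
        have "((\<lambda>h. norm (u (x + h *\<^sub>R ?e) - u x - h *\<^sub>R w x) / norm h) \<longlongrightarrow> 0) (at 0)"
          using deriv[of x] by (simp add: has_vector_derivative_def has_derivative_at)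
        then have "((\<lambda>h. norm ((u (x + h *\<^sub>R ?e) - u x) /\<^sub>R h - w x)) \<longlongrightarrow> 0) (at 0)"
        proof (rule Lim_transform_eventually)
          have "norm (a - h *\<^sub>R b) / norm h = norm (a /\<^sub>R h - b)" if "h \<noteq> 0" for a b :: 'b and h
          proof -
            have "a /\<^sub>R h - b = (a - h *\<^sub>R b) /\<^sub>R h" using that by (simp add: scaleR_diff_right)
            then show ?thesis by (simp add: divide_inverse mult.commute)
          qed
          then show "\<forall>\<^sub>F h in at 0. norm (u (x + h *\<^sub>R ?e) - u x - h *\<^sub>R w x) / norm h =
              norm ((u (x + h *\<^sub>R ?e) - u x) /\<^sub>R h - w x)"
            by (auto simp: eventually_at_filter)
        qed
        then show ?thesis using Lim_null tendsto_norm_zero_iff by blast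
      qed
      moreover have "filterlim (\<lambda>n. inverse (real (Suc n))) (at 0) sequentially"
        by (rule filterlim_atI[OF LIMSEQ_inverse_real_of_nat]) auto
      ultimately have "(\<lambda>n. (u (x + inverse (real (Suc n)) *\<^sub>R ?e) - u x) /\<^sub>R inverse (real (Suc n)))
          \<longlonglongrightarrow> w x" by (rule filterlim_compose)
      then show "(\<lambda>n. v n x) \<longlonglongrightarrow> w x" by (simp add: v_def)
    qed
    show "AE x in lborel. norm (v n x) \<le> B * indicator (cball 0 (R + 1)) x" for n
    proof (rule AE_I2)
      fix x
      let ?h = "inverse (real (Suc n))"
      have h: "?h \<le> 1" "norm (?h *\<^sub>R ?e) = ?h" by (auto simp: field_simps)
      have "norm (v n x) \<le> real (Suc n) * (B * \<bar>?h\<bar>)"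
        unfolding v_def norm_scaleR using lip[of x ?h] by (simp add: mult_left_mono del: of_nat_Suc)
      then have b: "norm (v n x) \<le> B" by (simp add: field_simps del: of_nat_Suc)
      have "v n x = 0" if "x \<notin> cball 0 (R + 1)"
      proof -
        have "u x = 0" using supp[of x] that by auto
        moreover have "norm x \<le> norm (x + ?h *\<^sub>R ?e) + norm (?h *\<^sub>R ?e)"
          by (metis add_diff_cancel norm_triangle_ineq4)
        then have "u (x + ?h *\<^sub>R ?e) = 0" using supp[of "x + ?h *\<^sub>R ?e"] that h by force
        ultimately show ?thesis by (simp add: v_def)
      qed
      then show "norm (v n x) \<le> B * indicator (cball 0 (R + 1)) x"
        using b by (auto simp: indicator_def)
    qed
  qed (auto simp: v_def[abs_def])
  moreover have "integral\<^sup>L lborel (v n) = 0" for n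
    using integral_affine[of 1 u "inverse (real (Suc n)) *\<^sub>R ?e"] int int'
    by (simp add: v_def[abs_def] Bochner_Integration.integral_diff del: of_nat_Suc)
  ultimately show ?thesis by (simp add: LIMSEQ_const_iff)
qed

lemma compact_support_in_cball:
  assumes "compact_support_in S (\<phi> :: 'a::euclidean_space \<Rightarrow> 'b::zero)"
  obtains R where "\<And>x. \<phi> x \<noteq> 0 \<Longrightarrow> norm x \<le> R"
proof -
  have "bounded (closure {x. \<phi> x \<noteq> 0})"
    using assms by (auto simp: compact_support_in_def compact_imp_bounded)
  then show ?thesis using that closure_subset[of "{x. \<phi> x \<noteq> 0}"] by (auto simp: bounded_iff)
qed

lemma continuous_on_extend_by_zero:
  fixes f :: "'a::topological_space \<Rightarrow> 'b::{topological_space, zero}"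
  assumes "open S" "continuous_on S f" "closed K" "K \<subseteq> S" "\<And>x. x \<notin> K \<Longrightarrow> f x = 0"
  shows "continuous_on UNIV f"
proof -
  have "continuous_on (S \<union> - K) f"
  proof (rule continuous_on_open_Un)
    show "continuous_on (- K) f"
      using continuous_on_cong[of "- K" "- K" f "\<lambda>_. 0"] assms(5) by simp
  qed (use assms in auto)
  moreover have "S \<union> - K = UNIV" using assms(4) by auto
  ultimately show ?thesis by simp
qed

lemma test_functions_partial:
  assumes "\<phi> \<in> test_functions S" shows "partial_deriv i \<phi> \<in> test_functions S"
proof -
  let ?K = "closure {x. \<phi> x \<noteq> 0}"
  have z: "partial_deriv i \<phi> x = 0" if "x \<notin> ?K" for x
  proof (rule partial_deriv_eqI)
    show "((\<lambda>t. \<phi> (x + t *\<^sub>R axis i 1)) has_vector_derivative 0) (at 0)"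
      by (rule has_partial_cong[of "- ?K" _ "\<lambda>_. 0"])
        (use that closure_subset[of "{x. \<phi> x \<noteq> 0}"] in auto)
  qed
  have sub: "closure {x. partial_deriv i \<phi> x \<noteq> 0} \<subseteq> ?K"
    by (rule closure_minimal) (use z in auto)
  have "\<phi> \<in> C_k (Suc k) UNIV" for k using assms by (simp add: test_functions_def)
  then show ?thesis
    using assms sub compact_Int_closed[of ?K "closure {x. partial_deriv i \<phi> x \<noteq> 0}"]
    by (auto simp: test_functions_def compact_support_in_def C_k.simps Int_absorb1)
qed

lemma test_functions_foldr:
  "\<phi> \<in> test_functions S \<Longrightarrow> foldr partial_deriv is \<phi> \<in> test_functions S"
  by (induction "is") (auto intro: test_functions_partial)

lemma test_functions_continuous: "\<phi> \<in> test_functions S \<Longrightarrow> continuous_on UNIV \<phi>"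
  using C_k_continuous_on by (auto simp: test_functions_def)

lemma test_functions_outside: "\<phi> \<in> test_functions S \<Longrightarrow> x \<notin> S \<Longrightarrow> \<phi> x = 0"
  using closure_subset[of "{x. \<phi> x \<noteq> 0}"] by (auto simp: test_functions_def compact_support_in_def)

lemma test_functions_scaleR_continuous:
  fixes G :: "real ^ 'n::finite \<Rightarrow> 'b::real_normed_vector"
  assumes "open S" "\<phi> \<in> test_functions S" "continuous_on S G"
  shows "continuous_on UNIV (\<lambda>x. \<phi> x *\<^sub>R G x)"
proof (rule continuous_on_extend_by_zero[OF assms(1)])
  show "continuous_on S (\<lambda>x. \<phi> x *\<^sub>R G x)"
    using test_functions_continuous[OF assms(2)] assms(3)
    by (intro continuous_intros) (auto intro: continuous_on_subset)
  show "closed (closure {x. \<phi> x \<noteq> 0})" by simp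
  show "closure {x. \<phi> x \<noteq> 0} \<subseteq> S"
    using assms(2) by (simp add: test_functions_def compact_support_in_def)
  show "\<phi> x *\<^sub>R G x = 0" if "x \<notin> closure {x. \<phi> x \<noteq> 0}" for x
    using that closure_subset[of "{x. \<phi> x \<noteq> 0}"] by auto
qed

lemma test_functions_scaleR_integrable:
  fixes G :: "real ^ 'n::finite \<Rightarrow> 'b::euclidean_space"
  assumes "open S" "\<phi> \<in> test_functions S" "continuous_on S G"
  shows "integrable lborel (\<lambda>x. \<phi> x *\<^sub>R G x)"
proof -
  obtain R where "\<And>x. \<phi> x \<noteq> 0 \<Longrightarrow> norm x \<le> R"
    using assms(2) compact_support_in_cball unfolding test_functions_def by blast
  then show ?thesis
    by (intro compactly_supported_integrable[OF test_functions_scaleR_continuous[OF assms]]) auto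
qed

text \<open>
  The function \<open>G\<close> may be singular or undefined off \<open>S\<close>: the product with \<open>\<phi>\<close> vanishes outside
  a compact subset of \<open>S\<close>, so it is differentiable everywhere and \<open>integral_partial_zero\<close> applies.
\<close>
lemma integration_by_parts:
  fixes G :: "real ^ 'n::finite \<Rightarrow> 'b::euclidean_space"
  assumes "open S" "\<phi> \<in> test_functions S" "G \<in> C_k 1 S"
  shows "(\<integral>x. partial_deriv i \<phi> x *\<^sub>R G x \<partial>lborel) = - (\<integral>x. \<phi> x *\<^sub>R partial_deriv i G x \<partial>lborel)"
proof -
  let ?w = "\<lambda>x. \<phi> x *\<^sub>R partial_deriv i G x + partial_deriv i \<phi> x *\<^sub>R G x"
  let ?K = "closure {x. \<phi> x \<noteq> 0}"
  have contG: "continuous_on S G" "continuous_on S (partial_deriv i G)" using assms(3) by (auto simp: C_k.simps)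
  have d\<phi>: "partial_deriv i \<phi> \<in> test_functions S" by (rule test_functions_partial[OF assms(2)])
  have K: "\<phi> x = 0" if "x \<notin> ?K" for x using that closure_subset[of "{x. \<phi> x \<noteq> 0}"] by auto
  have KS: "?K \<subseteq> S" using assms(2) by (simp add: test_functions_def compact_support_in_def)
  obtain R where R: "\<And>x. \<phi> x \<noteq> 0 \<Longrightarrow> norm x \<le> R"
    using assms(2) compact_support_in_cball unfolding test_functions_def by blast
  have D\<phi>: "((\<lambda>t. \<phi> (x + t *\<^sub>R axis i 1)) has_vector_derivative partial_deriv i \<phi> x) (at 0)" for x
    using assms(2) by (intro C_k_has_partial[of _ 0 UNIV]) (auto simp: test_functions_def)
  have "integral\<^sup>L lborel ?w = 0"
  proof (rule integral_partial_zero[of "\<lambda>x. \<phi> x *\<^sub>R G x"])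
    show "continuous_on UNIV ?w"
      by (intro continuous_intros test_functions_scaleR_continuous[OF assms(1)] assms(2) d\<phi> contG)
    show "((\<lambda>t. \<phi> (x + t *\<^sub>R axis i 1) *\<^sub>R G (x + t *\<^sub>R axis i 1)) has_vector_derivative ?w x) (at 0)"
      for x
    proof (cases "x \<in> S")
      case True
      have "((\<lambda>t. G (x + t *\<^sub>R axis i 1)) has_vector_derivative partial_deriv i G x) (at 0)"
        using C_k_has_partial[of G 0 S] assms(3) True by (simp add: C_k.simps)
      from has_vector_derivative_scaleR[of "\<lambda>t. \<phi> (x + t *\<^sub>R axis i 1)", OF _ this] D\<phi>[of x]
      show ?thesis by (simp add: has_real_derivative_iff_has_vector_derivative)
    next
      case False
      then have "x \<in> - ?K" using KS by auto
      then have "((\<lambda>t. \<phi> (x + t *\<^sub>R axis i 1) *\<^sub>R G (x + t *\<^sub>R axis i 1)) has_vector_derivative 0) (at 0)"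
        by (rule has_partial_cong[of "- ?K" x "\<lambda>_. 0", OF open_Compl[OF closed_closure]])
          (simp_all only: K Compl_iff scaleR_zero_left has_vector_derivative_const not_False_eq_True)
      then show ?thesis
        using test_functions_outside[OF d\<phi> False] test_functions_outside[OF assms(2) False] by simp
    qed
  qed (use R test_functions_scaleR_continuous[OF assms(1,2) contG(1)] in auto)
  moreover have "integral\<^sup>L lborel ?w =
      (\<integral>x. \<phi> x *\<^sub>R partial_deriv i G x \<partial>lborel) + (\<integral>x. partial_deriv i \<phi> x *\<^sub>R G x \<partial>lborel)"
    by (intro Bochner_Integration.integral_add test_functions_scaleR_integrable[OF assms(1)]
        assms(2) d\<phi> contG)
  ultimately show ?thesis by (simp add: eq_neg_iff_add_eq_0 add.commute)
qed

text \<open>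
  Moving the outermost derivative first reverses the order of differentiation, hence \<open>rev\<close>.
\<close>
lemma iterated_integration_by_parts:
  fixes G :: "real ^ 'n::finite \<Rightarrow> 'b::euclidean_space"
  assumes "open S" "\<phi> \<in> test_functions S" "G \<in> C_k (length is) S"
  shows "(\<integral>x. foldr partial_deriv is \<phi> x *\<^sub>R G x \<partial>lborel)
         = (-1) ^ length is *\<^sub>R (\<integral>x. \<phi> x *\<^sub>R foldr partial_deriv (rev is) G x \<partial>lborel)"
  using assms(3)
proof (induction "is" arbitrary: G)
  case Nil
  then show ?case by simp
next
  case (Cons i "is")
  have G1: "G \<in> C_k 1 S"
  proof -
    have "G \<in> C_k (Suc k) S \<Longrightarrow> G \<in> C_k 1 S" for k
      by (induction k) (auto dest: C_k_mono)
    then show ?thesis using Cons.prems by simp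
  qed
  have "(\<integral>x. foldr partial_deriv (i # is) \<phi> x *\<^sub>R G x \<partial>lborel)
      = - (\<integral>x. foldr partial_deriv is \<phi> x *\<^sub>R partial_deriv i G x \<partial>lborel)"
    using integration_by_parts[OF assms(1) test_functions_foldr[OF assms(2)] G1] by simp
  also have "\<dots> = - ((-1) ^ length is *\<^sub>R
      (\<integral>x. \<phi> x *\<^sub>R foldr partial_deriv (rev is) (partial_deriv i G) x \<partial>lborel))"
    using Cons by (simp add: C_k.simps)
  finally show ?case by simp
qed

section \<open>Local integrability of homogeneous kernels\<close>

definition locally_integrable ::
    "('a::euclidean_space \<Rightarrow> 'b::{banach, second_countable_topology}) \<Rightarrow> bool" where
  "locally_integrable G \<longleftrightarrow> G \<in> borel_measurable borel \<and>
     (\<forall>R. integrable lborel (\<lambda>x. indicator (ball 0 R) x *\<^sub>R G x))"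

lemma inverse_norm_power_le_dyadic:
  fixes x :: "'a::real_normed_vector"
  assumes "x \<noteq> 0" "norm x < R"
  obtains k where "norm x < R / 2 ^ k" "inverse (norm x) ^ m \<le> (2 ^ Suc k / R) ^ m"
proof -
  have R: "R > 0" using assms by (meson le_less_trans norm_ge_zero)
  obtain n where "R / norm x < 2 ^ n" using real_arch_pow[of 2 "R / norm x"] by auto
  then have "R / 2 ^ Suc n \<le> norm x" using assms(1) R by (simp add: field_simps)
  then have ex: "\<exists>n. R / 2 ^ Suc n \<le> norm x" by blast
  define k where "k = (LEAST n. R / 2 ^ Suc n \<le> norm x)"
  have k: "R / 2 ^ Suc k \<le> norm x" unfolding k_def by (rule LeastI_ex[OF ex])
  have "norm x < R / 2 ^ k"
  proof (cases k)
    case 0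
    then show ?thesis using assms by simp
  next
    case (Suc l)
    then have "l < (LEAST n. R / 2 ^ Suc n \<le> norm x)" by (simp only: k_def)
    then have "\<not> R / 2 ^ Suc l \<le> norm x" by (rule not_less_Least)
    then show ?thesis using Suc by simp
  qed
  moreover have "inverse (norm x) \<le> 2 ^ Suc k / R"
    using k assms(1) R by (simp add: field_simps)
  then have "inverse (norm x) ^ m \<le> (2 ^ Suc k / R) ^ m" by (intro power_mono) auto
  ultimately show ?thesis by (rule that)
qed

text \<open>
  On the ball of radius \<open>R\<close> the function is dominated by a sum over dyadic balls, as the
  integral over the ball of radius \<open>R / 2 ^ k\<close> is of order \<open>2 ^ (m * k) / 2 ^ (d * k)\<close>. The resulting
  series is geometric because \<open>m < d\<close>.
\<close>
lemma integrable_inverse_norm_power: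
  assumes "m < DIM('a::euclidean_space)"
  shows "integrable lborel (\<lambda>x :: 'a. indicator (ball 0 R) x * inverse (norm x) ^ m)"
proof (cases "R > 0")
  case False
  then have empty: "ball 0 R = ({} :: 'a set)" by simp
  show ?thesis unfolding empty by simp
next
  case R: True
  let ?d = "DIM('a)" and ?v = "unit_ball_vol (real DIM('a))"
  let ?b = "\<lambda>k. (2 ^ Suc k / R) ^ m * (?v * (R / 2 ^ k) ^ ?d)"
  have v: "?v \<ge> 0" by simp
  have b: "?b k \<le> (2 / R) ^ m * ?v * R ^ ?d * (1 / 2) ^ k" for k
  proof -
    have "(2 ^ k) ^ m * (1 / 2 ^ k) ^ ?d = (1 / 2 ^ k :: real) ^ (?d - m)"
      using assms by (simp add: power_diff field_simps)
    also have "\<dots> \<le> (1 / 2 ^ k) ^ 1"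
      using assms by (intro power_decreasing) auto
    finally have q: "(2 ^ k) ^ m * (1 / 2 ^ k) ^ ?d \<le> (1 / 2 :: real) ^ k"
      by (simp add: power_divide)
    have "?b k = (2 / R) ^ m * ?v * R ^ ?d * ((2 ^ k) ^ m * (1 / 2 ^ k) ^ ?d)"
      by (simp add: power_divide power_mult_distrib)
    also have "\<dots> \<le> (2 / R) ^ m * ?v * R ^ ?d * (1 / 2) ^ k"
      by (rule mult_left_mono[OF q]) (use R v in simp)
    finally show ?thesis .
  qed
  have summ: "summable ?b"
  proof (rule summable_comparison_test)
    show "\<exists>N. \<forall>k\<ge>N. norm (?b k) \<le> (2 / R) ^ m * ?v * R ^ ?d * (1 / 2) ^ k"
      using b R v by auto
    show "summable (\<lambda>k. (2 / R) ^ m * ?v * R ^ ?d * (1 / 2) ^ k)"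
      by (intro summable_mult summable_geometric) simp
  qed
  have term_le: "h k \<le> suminf h" for h :: "nat \<Rightarrow> ennreal" and k
    using sum_le_suminf[of h "{k}"] by simp
  have "(\<integral>\<^sup>+x. norm (indicator (ball 0 R) x * inverse (norm x) ^ m) \<partial>(lborel :: 'a measure))
      \<le> (\<integral>\<^sup>+x. (\<Sum>k. ennreal ((2 ^ Suc k / R) ^ m) * indicator (ball 0 (R / 2 ^ k)) x) \<partial>(lborel :: 'a measure))"
  proof (rule nn_integral_mono_AE)
    show "AE x in (lborel :: 'a measure). ennreal (norm (indicator (ball 0 R) x * inverse (norm x) ^ m))
        \<le> (\<Sum>k. ennreal ((2 ^ Suc k / R) ^ m) * indicator (ball 0 (R / 2 ^ k)) x)"
      using AE_lborel_singleton[of 0]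
    proof eventually_elim
      case (elim x)
      show ?case
      proof (cases "norm x < R")
        case True
        obtain k where k: "norm x < R / 2 ^ k" "inverse (norm x) ^ m \<le> (2 ^ Suc k / R) ^ m"
          using inverse_norm_power_le_dyadic elim True by metis
        have "ennreal (norm (indicator (ball 0 R) x * inverse (norm x) ^ m))
            \<le> ennreal ((2 ^ Suc k / R) ^ m) * indicator (ball 0 (R / 2 ^ k)) x"
          using k True by (auto intro!: ennreal_leI)
        also have "\<dots> \<le> (\<Sum>j. ennreal ((2 ^ Suc j / R) ^ m) * indicator (ball 0 (R / 2 ^ j)) x)"
          by (rule term_le)
        finally show ?thesis .
      qed simp
    qed
  qed
  also have "\<dots> = (\<Sum>k. \<integral>\<^sup>+x. ennreal ((2 ^ Suc k / R) ^ m) * indicator (ball 0 (R / 2 ^ k)) x \<partial>(lborel :: 'a measure))"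
    by (rule nn_integral_suminf) (auto intro!: borel_measurable_times_ennreal borel_measurable_indicator)
  also have "\<dots> = (\<Sum>k. ennreal (?b k))"
  proof (intro suminf_cong)
    fix k
    show "(\<integral>\<^sup>+x. ennreal ((2 ^ Suc k / R) ^ m) * indicator (ball 0 (R / 2 ^ k)) x \<partial>(lborel :: 'a measure))
        = ennreal (?b k)"
      by (subst nn_integral_cmult_indicator) (use R in \<open>auto simp: emeasure_ball ennreal_mult\<close>)
  qed
  also have "\<dots> = ennreal (\<Sum>k. ?b k)"
    using R by (intro suminf_ennreal2 summ) auto
  finally show ?thesis
    by (intro integrableI_bounded)
      (auto intro: le_less_trans intro!: borel_measurable_times borel_measurable_indicator)
qed

lemma smooth_homogeneous_locally_integrable:
  fixes G :: "real ^ 'n::finite \<Rightarrow> 'b::euclidean_space"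
  assumes "smooth_homogeneous m G" "m < CARD('n)"
  shows "locally_integrable G"
  unfolding locally_integrable_def
proof (intro conjI allI)
  show meas: "G \<in> borel_measurable borel"
    by (rule borel_measurable_continuous_countable_exceptions[of "{0}"])
      (use smooth_homogeneous_continuous[OF assms(1)] in auto)
  fix R
  obtain C where C: "C > 0" "\<And>x. x \<noteq> 0 \<Longrightarrow> norm (G x) \<le> C * inverse (norm x) ^ m"
    using smooth_homogeneous_bound[OF assms(1)] by metis
  show "integrable lborel (\<lambda>x. indicator (ball 0 R) x *\<^sub>R G x)"
  proof (rule Bochner_Integration.integrable_bound)
    show "integrable lborel (\<lambda>x :: real ^ 'n. C * (indicator (ball 0 R) x * inverse (norm x) ^ m))"
      using assms(2) by (intro integrable_mult_right integrable_inverse_norm_power) simp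
    show "AE x in lborel. norm (indicator (ball 0 R) x *\<^sub>R G x)
        \<le> norm (C * (indicator (ball 0 R) x * inverse (norm x) ^ m))"
      using AE_lborel_singleton[of 0]
    proof eventually_elim
      case (elim x)
      then show ?case using C by (auto simp: indicator_def)
    qed
  qed (auto intro!: borel_measurable_scaleR borel_measurable_indicator meas)
qed

section \<open>Convolution with a singular kernel\<close>

definition convolution :: "('a::euclidean_space \<Rightarrow> real) \<Rightarrow> ('a \<Rightarrow> 'b::euclidean_space) \<Rightarrow> 'a \<Rightarrow> 'b" where
  "convolution f G x = (\<integral>z. f z *\<^sub>R G (x - z) \<partial>lborel)"

context
  fixes f :: "'a::euclidean_space \<Rightarrow> real" and G :: "'a \<Rightarrow> 'b::euclidean_space" and R :: real
  assumes cont: "continuous_on UNIV f" and supp: "\<And>x. f x \<noteq> 0 \<Longrightarrow> norm x \<le> R"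
    and G: "locally_integrable G"
begin

lemma conv_dominating:
  obtains M where "M > 0" and
    "\<And>x y B. norm x \<le> B \<Longrightarrow> norm (f (x - y) *\<^sub>R G y) \<le> M * norm (indicator (ball 0 (B + R + 1)) y *\<^sub>R G y)"
proof -
  obtain M where M: "M > 0" "\<And>x. norm (f x) \<le> M"
    using compactly_supported_bounded[OF cont supp] by blast
  have "norm (f (x - y) *\<^sub>R G y) \<le> M * norm (indicator (ball 0 (B + R + 1)) y *\<^sub>R G y)"
    if "norm x \<le> B" for x y B
  proof (cases "f (x - y) = 0")
    case True
    then show ?thesis using M by simp
  next
    case False
    have "norm y \<le> norm x + norm (x - y)" using norm_triangle_ineq2[of y x] by (simp add: norm_minus_commute)
    then have "y \<in> ball 0 (B + R + 1)" using supp[OF False] that by simp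
    then show ?thesis using M(2)[of "x - y"] by (simp add: mult_right_mono)
  qed
  with M(1) show ?thesis by (rule that)
qed

lemma conv_integrable_reflected: "integrable lborel (\<lambda>y. f (x - y) *\<^sub>R G y)"
proof -
  have [measurable]: "f \<in> borel_measurable borel" "G \<in> borel_measurable borel"
    using cont G by (auto simp: locally_integrable_def intro: borel_measurable_continuous_onI)
  obtain M where M: "M > 0"
    "\<And>x y B. norm x \<le> B \<Longrightarrow> norm (f (x - y) *\<^sub>R G y) \<le> M * norm (indicator (ball 0 (B + R + 1)) y *\<^sub>R G y)"
    using conv_dominating by blast
  show ?thesis
  proof (rule Bochner_Integration.integrable_bound)
    show "integrable lborel (\<lambda>y. M * norm (indicator (ball 0 (norm x + R + 1)) y *\<^sub>R G y))"
      using G by (intro integrable_mult_right integrable_norm) (simp add: locally_integrable_def)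
    show "AE y in lborel. norm (f (x - y) *\<^sub>R G y)
        \<le> norm (M * norm (indicator (ball 0 (norm x + R + 1)) y *\<^sub>R G y))"
      using M(2)[of x "norm x"] M(1) by (auto simp: abs_mult)
  qed measurable
qed

lemma conv_integrable: "integrable lborel (\<lambda>z. f z *\<^sub>R G (x - z))"
  using integrable_affine[of "-1" "\<lambda>y. f (x - y) *\<^sub>R G y" x, OF _ conv_integrable_reflected]
  by simp

lemma conv_reflected: "convolution f G x = (\<integral>y. f (x - y) *\<^sub>R G y \<partial>lborel)"
  using integral_affine[of "-1" "\<lambda>y. f (x - y) *\<^sub>R G y" x]
    borel_measurable_integrable[OF conv_integrable_reflected[of x]]
  by (simp add: convolution_def)

text \<open>
  After the substitution \<open>y = x - z\<close> the dependence on \<open>x\<close> sits in the continuous factor \<open>f\<close>, and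
  the singularity of \<open>G\<close> no longer moves; dominated convergence applies.
\<close>
lemma conv_continuous: "continuous_on UNIV (convolution f G)"
proof (rule continuous_on_sequentiallyI)
  fix u :: "nat \<Rightarrow> 'a" and a assume u: "u \<longlonglongrightarrow> a"
  have [measurable]: "f \<in> borel_measurable borel" "G \<in> borel_measurable borel"
    using cont G by (auto simp: locally_integrable_def intro: borel_measurable_continuous_onI)
  obtain M where M: "M > 0"
    "\<And>x y B. norm x \<le> B \<Longrightarrow> norm (f (x - y) *\<^sub>R G y) \<le> M * norm (indicator (ball 0 (B + R + 1)) y *\<^sub>R G y)"
    using conv_dominating by blast
  have "bounded (range u)" using u by (intro convergent_imp_bounded) (auto simp: convergent_def)
  then obtain B where B: "\<And>n. norm (u n) \<le> B" by (auto simp: bounded_iff)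
  show "(\<lambda>n. convolution f G (u n)) \<longlonglongrightarrow> convolution f G a"
    unfolding conv_reflected
  proof (rule integral_dominated_convergence)
    show "integrable lborel (\<lambda>y. M * norm (indicator (ball 0 (B + R + 1)) y *\<^sub>R G y))"
      using G by (intro integrable_mult_right integrable_norm) (simp add: locally_integrable_def)
    show "AE y in lborel. norm (f (u n - y) *\<^sub>R G y) \<le> M * norm (indicator (ball 0 (B + R + 1)) y *\<^sub>R G y)" for n
      using M(2)[OF B] by auto
    show "AE y in lborel. (\<lambda>n. f (u n - y) *\<^sub>R G y) \<longlonglongrightarrow> f (a - y) *\<^sub>R G y"
    proof (rule AE_I2)
      fix y
      have "(\<lambda>n. f (u n - y)) \<longlonglongrightarrow> f (a - y)"
        by (rule continuous_on_tendsto_compose[OF cont]) (auto intro!: tendsto_intros u)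
      then show "(\<lambda>n. f (u n - y) *\<^sub>R G y) \<longlonglongrightarrow> f (a - y) *\<^sub>R G y" by (intro tendsto_intros)
    qed
  qed measurable
qed

end

text \<open>
  The difference quotients of a singular kernel have no obvious common majorant, so differentiation
  under the integral is done in integrated form: for almost every \<open>z\<close> the segment from \<open>x - z + a e\<^sub>i\<close>
  to \<open>x - z + b e\<^sub>i\<close> misses the origin and the fundamental theorem of calculus applies to \<open>G\<close> along
  it; Fubini exchanges the two integrations, which is legitimate because \<open>G'\<close> is locally integrable.
  The exceptional points \<open>z\<close> lie on a line, a null set in dimension at least two.
\<close>
lemma conv_increment:
  fixes G :: "real ^ 'n::finite \<Rightarrow> 'b::euclidean_space"
  assumes card: "CARD('n) \<ge> 2"
    and cont: "continuous_on UNIV f" and supp: "\<And>x. f x \<noteq> 0 \<Longrightarrow> norm x \<le> R"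
    and G: "locally_integrable G" "locally_integrable G'"
    and deriv: "\<And>y. y \<noteq> 0 \<Longrightarrow> ((\<lambda>t. G (y + t *\<^sub>R axis i 1)) has_vector_derivative G' y) (at 0)"
    and contG': "continuous_on (- {0}) G'"
    and "a \<le> b"
  shows "convolution f G (x + b *\<^sub>R axis i 1) - convolution f G (x + a *\<^sub>R axis i 1)
    = integral {a..b} (\<lambda>s. convolution f G' (x + s *\<^sub>R axis i 1))"
proof -
  let ?e = "axis i 1 :: real ^ 'n"
  have [measurable]: "f \<in> borel_measurable borel" "G' \<in> borel_measurable borel"
    using cont G by (auto simp: locally_integrable_def intro: borel_measurable_continuous_onI)
  define \<Phi> where "\<Phi> s z = indicator {a..b} s *\<^sub>R f z *\<^sub>R G' (x + s *\<^sub>R ?e - z)" for s z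
  have loc: "locally_integrable (\<lambda>y. norm (G' y))"
    unfolding locally_integrable_def
  proof (intro conjI allI)
    fix r
    have "integrable lborel (\<lambda>x. norm (indicator (ball 0 r) x *\<^sub>R G' x))"
      using G(2) by (intro integrable_norm) (simp add: locally_integrable_def)
    then show "integrable lborel (\<lambda>x. indicator (ball 0 r) x *\<^sub>R norm (G' x))" by simp
  qed measurable
  have cont_line: "continuous_on A (\<lambda>s. h (x + s *\<^sub>R ?e))" if "continuous_on UNIV h"
    for A and h :: "real ^ 'n \<Rightarrow> 'c::topological_space"
    by (rule continuous_on_compose2[OF that]) (auto intro!: continuous_intros)
  have int: "integrable (lborel \<Otimes>\<^sub>M lborel) (case_prod \<Phi>)"
  proof (rule lborel_pair.Fubini_integrable)
    show "case_prod \<Phi> \<in> borel_measurable (lborel \<Otimes>\<^sub>M lborel)"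
      unfolding \<Phi>_def split_beta' by measurable
    have eq: "(\<integral>z. norm (case_prod \<Phi> (s, z)) \<partial>lborel)
        = indicator {a..b} s *\<^sub>R convolution (\<lambda>z. \<bar>f z\<bar>) (\<lambda>y. norm (G' y)) (x + s *\<^sub>R ?e)" for s
      by (cases "s \<in> {a..b}") (simp_all add: \<Phi>_def convolution_def)
    have "continuous_on UNIV (convolution (\<lambda>z. \<bar>f z\<bar>) (\<lambda>y. norm (G' y)))"
      by (rule conv_continuous[where R = R]) (use supp loc cont in \<open>auto intro!: continuous_intros\<close>)
    then show "integrable lborel (\<lambda>s. \<integral>z. norm (case_prod \<Phi> (s, z)) \<partial>lborel)"
      unfolding eq by (intro borel_integrable_compact cont_line) auto
    show "AE s in lborel. integrable lborel (\<lambda>z. case_prod \<Phi> (s, z))"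
      unfolding \<Phi>_def split_conv
      by (intro AE_I2 integrable_scaleR_right conv_integrable[OF cont supp G(2)])
  qed
  have contH: "continuous_on UNIV (convolution f G')" by (rule conv_continuous[OF cont supp G(2)])
  have "integral {a..b} (\<lambda>s. convolution f G' (x + s *\<^sub>R ?e)) = (\<integral>s. (\<integral>z. \<Phi> s z \<partial>lborel) \<partial>lborel)"
  proof -
    have "set_integrable lborel {a..b} (\<lambda>s. convolution f G' (x + s *\<^sub>R ?e))"
      unfolding set_integrable_def by (intro borel_integrable_compact cont_line contH) auto
    from set_borel_integral_eq_integral(2)[OF this] show ?thesis
      by (simp add: set_lebesgue_integral_def \<Phi>_def convolution_def del: scaleR_scaleR)
  qed
  also have "\<dots> = (\<integral>z. (\<integral>s. \<Phi> s z \<partial>lborel) \<partial>lborel)"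
    by (rule lborel_pair.Fubini_integral[OF int, symmetric])
  also have "\<dots> = (\<integral>z. f z *\<^sub>R G (x + b *\<^sub>R ?e - z) - f z *\<^sub>R G (x + a *\<^sub>R ?e - z) \<partial>lborel)"
  proof (rule integral_cong_AE)
    show "(\<lambda>z. \<integral>s. \<Phi> s z \<partial>lborel) \<in> borel_measurable lborel"
      using lborel_pair.integrable_snd[OF int] by auto
    show "(\<lambda>z. f z *\<^sub>R G (x + b *\<^sub>R ?e - z) - f z *\<^sub>R G (x + a *\<^sub>R ?e - z)) \<in> borel_measurable lborel"
      using conv_integrable[OF cont supp G(1)] by (intro borel_measurable_diff borel_measurable_integrable)
    obtain j where j: "j \<noteq> i"
      using card card_2_iff' ex_card[of 2 "UNIV :: 'n set"] by (metis UNIV_I)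
    show "AE z in lborel. (\<integral>s. \<Phi> s z \<partial>lborel) = f z *\<^sub>R G (x + b *\<^sub>R ?e - z) - f z *\<^sub>R G (x + a *\<^sub>R ?e - z)"
      using AE_lborel_inner_neq[of "axis j 1 :: real ^ 'n" "x $ j", simplified]
    proof eventually_elim
      case (elim z)
      have ne: "x + s *\<^sub>R ?e - z \<noteq> 0" for s
      proof
        assume "x + s *\<^sub>R ?e - z = 0"
        then have "(x + s *\<^sub>R ?e - z) $ j = 0" by simp
        then show False using elim j by (simp add: inner_axis) (simp add: axis_def)
      qed
      have D: "((\<lambda>s. G (x - z + s *\<^sub>R ?e)) has_vector_derivative G' (x - z + s *\<^sub>R ?e)) (at s)" for s
        by (rule has_partial_shift, rule deriv) (use ne[of s] in \<open>simp add: algebra_simps\<close>)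
      have "(\<integral>s. indicator {a..b} s *\<^sub>R G' (x - z + s *\<^sub>R ?e) \<partial>lborel)
          = G (x - z + b *\<^sub>R ?e) - G (x - z + a *\<^sub>R ?e)"
      proof (rule integral_FTC_Icc[OF \<open>a \<le> b\<close>])
        show "((\<lambda>s. G (x - z + s *\<^sub>R ?e)) has_vector_derivative G' (x - z + s *\<^sub>R ?e)) (at s within {a..b})" for s
          using D by (rule has_vector_derivative_at_within)
        have "(\<lambda>s. x - z + s *\<^sub>R ?e) ` {a..b} \<subseteq> - {0}"
        proof (rule image_subsetI)
          show "x - z + s *\<^sub>R ?e \<in> - {0}" for s using ne[of s] by (simp add: algebra_simps)
        qed
        then show "continuous_on {a..b} (\<lambda>s. G' (x - z + s *\<^sub>R ?e))"
          by (intro continuous_on_compose2[OF contG'] continuous_intros)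
      qed
      moreover have "(\<integral>s. \<Phi> s z \<partial>lborel) = f z *\<^sub>R (\<integral>s. indicator {a..b} s *\<^sub>R G' (x - z + s *\<^sub>R ?e) \<partial>lborel)"
        unfolding \<Phi>_def by (subst integral_scaleR_right[symmetric]) (simp add: scaleR_left_commute algebra_simps)
      ultimately show ?case
        by (simp add: scaleR_diff_right diff_add_eq)
    qed
  qed
  also have "\<dots> = convolution f G (x + b *\<^sub>R ?e) - convolution f G (x + a *\<^sub>R ?e)"
    unfolding convolution_def by (intro Bochner_Integration.integral_diff conv_integrable[OF cont supp G(1)])
  finally show ?thesis ..
qed

lemma conv_has_partial:
  fixes G :: "real ^ 'n::finite \<Rightarrow> 'b::euclidean_space"
  assumes card: "CARD('n) \<ge> 2"
    and cont: "continuous_on UNIV f" and supp: "\<And>x. f x \<noteq> 0 \<Longrightarrow> norm x \<le> R"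
    and G: "locally_integrable G" "locally_integrable G'"
    and deriv: "\<And>y. y \<noteq> 0 \<Longrightarrow> ((\<lambda>t. G (y + t *\<^sub>R axis i 1)) has_vector_derivative G' y) (at 0)"
    and contG': "continuous_on (- {0}) G'"
  shows "((\<lambda>t. convolution f G (x + t *\<^sub>R axis i 1)) has_vector_derivative convolution f G' x) (at 0)"
proof -
  let ?h = "\<lambda>s. convolution f G' (x + s *\<^sub>R axis i 1)"
  have "continuous_on UNIV (convolution f G')" by (rule conv_continuous[OF cont supp G(2)])
  then have "continuous_on {-1..1} ?h"
    by (rule continuous_on_compose2) (auto intro!: continuous_intros)
  then have "((\<lambda>u. integral {-1..u} ?h) has_vector_derivative ?h 0) (at 0 within {-1..1})"
    by (rule integral_has_vector_derivative) auto
  from has_vector_derivative_add[OF has_vector_derivative_const this]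
  have "((\<lambda>u. convolution f G (x + (-1) *\<^sub>R axis i 1) + integral {-1..u} ?h) has_vector_derivative convolution f G' x)
      (at 0 within {-1..1})" by simp
  then have "((\<lambda>t. convolution f G (x + t *\<^sub>R axis i 1)) has_vector_derivative convolution f G' x) (at 0 within {-1..1})"
  proof (rule has_vector_derivative_transform[rotated 2])
    show "convolution f G (x + u *\<^sub>R axis i 1) = convolution f G (x + (-1) *\<^sub>R axis i 1) + integral {-1..u} ?h"
      if "u \<in> {-1..1}" for u
      using conv_increment[OF card cont supp G deriv contG', of "-1" u x] that
      by (simp add: algebra_simps)
  qed auto
  then show ?thesis by (simp add: at_within_Icc_at)
qed

text \<open>
  Each derivative raises the order of homogeneity by one, and the kernels stay locally integrable as
  long as that order remains below the dimension.
\<close>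
lemma conv_C_k:
  fixes G :: "real ^ 'n::finite \<Rightarrow> 'b::euclidean_space"
  assumes card: "CARD('n) \<ge> 2"
    and cont: "continuous_on UNIV f" and supp: "\<And>x. f x \<noteq> 0 \<Longrightarrow> norm x \<le> R"
    and "smooth_homogeneous m G" "m + k < CARD('n)"
  shows "convolution f G \<in> C_k k UNIV"
  using assms(4,5)
proof (induction k arbitrary: m G)
  case 0
  then show ?case
    using conv_continuous[OF cont supp smooth_homogeneous_locally_integrable[of m G]]
    by (simp add: C_k.simps)
next
  case (Suc k)
  have hom: "smooth_homogeneous (Suc m) (partial_deriv i G)" for i
    by (rule smooth_homogeneous_partial[OF Suc.prems(1)])
  have loc: "locally_integrable G" "locally_integrable (partial_deriv i G)" for i
    by (rule smooth_homogeneous_locally_integrable[OF Suc.prems(1)],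
        use Suc.prems(2) in simp,
        rule smooth_homogeneous_locally_integrable[OF hom], use Suc.prems(2) in simp)
  have D: "((\<lambda>t. convolution f G (x + t *\<^sub>R axis i 1)) has_vector_derivative convolution f (partial_deriv i G) x) (at 0)"
    for x i
  proof (rule conv_has_partial[OF card cont supp loc])
    show "((\<lambda>t. G (y + t *\<^sub>R axis i 1)) has_vector_derivative partial_deriv i G y) (at 0)" if "y \<noteq> 0" for y
      by (rule C_k_has_partial[OF smooth_homogeneous_C_k[OF Suc.prems(1)]]) (use that in auto)
    show "continuous_on (- {0}) (partial_deriv i G)" by (rule smooth_homogeneous_continuous[OF hom])
  qed
  show ?case
  proof (rule C_k_Suc_I[OF _ D])
    show "continuous_on UNIV (convolution f G)" by (rule conv_continuous[OF cont supp loc(1)])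
    have "partial_deriv i (convolution f G) = convolution f (partial_deriv i G)" for i
      using partial_deriv_eqI[OF D] by blast
    then show "partial_deriv i (convolution f G) \<in> C_k k UNIV" for i
      using Suc.IH[OF hom[of i]] Suc.prems(2) by simp
  qed
qed

section \<open>Superposition of dyadic copies of a bump\<close>

lemma integral_pos_continuous:
  fixes g :: "'a::euclidean_space \<Rightarrow> real"
  assumes "continuous_on UNIV g" "integrable lborel g" "\<And>x. 0 \<le> g x" "g x0 \<noteq> 0"
  shows "0 < integral\<^sup>L lborel g"
proof -
  have "integral\<^sup>L lborel g \<noteq> 0"
  proof
    assume "integral\<^sup>L lborel g = 0"
    then have "AE x in lborel. g x = 0"
      using integral_nonneg_eq_0_iff_AE[OF assms(2)] assms(3) by auto
    then have "negligible {x. g x \<noteq> 0}"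
      by (simp add: AE_iff_null_sets negligible_iff_null_sets null_sets_completionI
          eventually_ae_filter) (metis (mono_tags, lifting) mem_Collect_eq null_sets_completion_subset
            null_sets_completionI subsetI)
    moreover have "open {x. g x \<noteq> 0}"
      using assms(1) by (intro open_Collect_neq) (auto intro!: continuous_intros)
    ultimately show False using open_not_negligible assms(4) by blast
  qed
  moreover have "0 \<le> integral\<^sup>L lborel g" using assms(3) by (intro integral_nonneg_AE) auto
  ultimately show ?thesis by simp
qed

text \<open>
  The heights \<open>1 / (k + 1)\<close> tend to \<open>0\<close>, which gives continuity at the origin, but have a divergent
  sum, which gives the blow-up.
\<close>
definition dyadic_term :: "('a::real_normed_vector \<Rightarrow> real) \<Rightarrow> nat \<Rightarrow> 'a \<Rightarrow> real" where
  "dyadic_term \<beta> k z = inverse (real (Suc k)) * \<beta> (2 ^ k *\<^sub>R z)"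

definition dyadic_sum :: "('a::real_normed_vector \<Rightarrow> real) \<Rightarrow> 'a \<Rightarrow> real" where
  "dyadic_sum \<beta> z = (\<Sum>k. dyadic_term \<beta> k z)"

lemma continuous_dyadic_term:
  assumes "continuous_on UNIV \<beta>" shows "continuous_on A (dyadic_term \<beta> k)"
  unfolding dyadic_term_def[abs_def]
  by (intro continuous_intros continuous_on_compose2[OF assms]) auto

context
  fixes \<beta> :: "'a::real_normed_vector \<Rightarrow> real" and \<rho> B :: real
  assumes nonneg: "\<And>w. 0 \<le> \<beta> w" and bound: "\<And>w. \<beta> w \<le> B"
    and annulus: "\<And>w. \<beta> w \<noteq> 0 \<Longrightarrow> \<rho> < norm w \<and> norm w < 2 * \<rho>"
begin

text \<open>
  The annulus \<open>\<rho> < norm w < 2 * \<rho>\<close> is disjoint from all its dyadic dilates.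
\<close>
lemma dyadic_term_unique:
  assumes "dyadic_term \<beta> j z \<noteq> 0" "dyadic_term \<beta> k z \<noteq> 0" shows "j = k"
proof -
  have le: "\<not> j < k" if "dyadic_term \<beta> j z \<noteq> 0" "dyadic_term \<beta> k z \<noteq> 0" for j k
  proof
    assume "j < k"
    have "\<rho> < 2 ^ j * norm z" "2 ^ k * norm z < 2 * \<rho>"
      using that annulus[of "2 ^ j *\<^sub>R z"] annulus[of "2 ^ k *\<^sub>R z"]
      by (auto simp: dyadic_term_def)
    moreover have "2 ^ Suc j * norm z \<le> 2 ^ k * norm z"
      using \<open>j < k\<close> by (intro mult_right_mono power_increasing) auto
    ultimately show False by simp
  qed
  show ?thesis using le[OF assms] le[OF assms(2,1)] by simp
qed

text \<open>
  By disjointness the remainder at a point is either \<open>0\<close> or a single term of index at least \<open>n\<close>.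
  The height estimate gives uniform convergence, and the support estimate shows that the shells of
  index at least \<open>n\<close> lie in a ball of radius proportional to \<open>1 / 2 ^ n\<close>.
\<close>
lemma dyadic_remainder:
  defines "r \<equiv> \<lambda>n z. dyadic_sum \<beta> z - (\<Sum>k<n. dyadic_term \<beta> k z)"
  shows "0 \<le> r n z" "r n z \<le> B * inverse (real (Suc n))" "r n z \<noteq> 0 \<Longrightarrow> norm z < 2 * \<rho> / 2 ^ n"
proof -
  have "0 \<le> r n z \<and> r n z \<le> B * inverse (real (Suc n)) \<and> (r n z \<noteq> 0 \<longrightarrow> norm z < 2 * \<rho> / 2 ^ n)"
  proof (cases "\<exists>k. dyadic_term \<beta> k z \<noteq> 0")
    case False
    then have "r n z = 0" by (simp add: r_def dyadic_sum_def)
    moreover have "0 \<le> B" using nonneg[of 0] bound[of 0] by linarith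
    ultimately show ?thesis by simp
  next
    case True
    then obtain k where k: "dyadic_term \<beta> k z \<noteq> 0" by blast
    have other: "dyadic_term \<beta> j z = 0" if "j \<noteq> k" for j using dyadic_term_unique[OF k] that by metis
    have "dyadic_sum \<beta> z = dyadic_term \<beta> k z"
      unfolding dyadic_sum_def using suminf_finite[of "{k}" "\<lambda>j. dyadic_term \<beta> j z"] other by simp
    moreover have "(\<Sum>j<n. dyadic_term \<beta> j z) = (if k < n then dyadic_term \<beta> k z else 0)"
      using sum.delta[of "{..<n}" k "\<lambda>j. dyadic_term \<beta> j z"] other
      by (simp add: sum.cong[of "{..<n}" "{..<n}" "\<lambda>j. dyadic_term \<beta> j z" "\<lambda>j. if j = k then dyadic_term \<beta> j z else 0"])
    ultimately have r: "r n z = (if k < n then 0 else dyadic_term \<beta> k z)" by (simp add: r_def)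
    have B: "0 \<le> B" using nonneg[of 0] bound[of 0] by linarith
    have "dyadic_term \<beta> k z \<le> B * inverse (real (Suc n))" if "n \<le> k"
    proof -
      have "inverse (real (Suc k)) \<le> inverse (real (Suc n))" using that by (simp add: field_simps)
      then have "inverse (real (Suc k)) * \<beta> (2 ^ k *\<^sub>R z) \<le> inverse (real (Suc n)) * B"
        using nonneg bound by (intro mult_mono) auto
      then show ?thesis by (simp add: dyadic_term_def mult.commute)
    qed
    moreover have "norm z < 2 * \<rho> / 2 ^ n" if "n \<le> k"
    proof -
      have "2 ^ k * norm z < 2 * \<rho>"
        using annulus[of "2 ^ k *\<^sub>R z"] k by (auto simp: dyadic_term_def)
      moreover have "2 ^ n * norm z \<le> 2 ^ k * norm z"
        using that by (intro mult_right_mono power_increasing) auto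
      ultimately show ?thesis by (simp add: field_simps)
    qed
    moreover have "0 \<le> dyadic_term \<beta> k z" using nonneg by (simp add: dyadic_term_def)
    ultimately show ?thesis using r B by auto
  qed
  then show "0 \<le> r n z" "r n z \<le> B * inverse (real (Suc n))" "r n z \<noteq> 0 \<Longrightarrow> norm z < 2 * \<rho> / 2 ^ n"
    by auto
qed

lemma dyadic_sum_nonneg: "0 \<le> dyadic_sum \<beta> z"
  using dyadic_remainder(1)[of z 0] by simp

lemma dyadic_sum_support: "dyadic_sum \<beta> z \<noteq> 0 \<Longrightarrow> norm z < 2 * \<rho>"
  using dyadic_remainder(3)[of z 0] by simp

lemma dyadic_sum_ge: "\<beta> z \<le> dyadic_sum \<beta> z"
  using dyadic_remainder(1)[of z 1] by (simp add: dyadic_term_def)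

lemma continuous_dyadic_sum:
  assumes "continuous_on UNIV \<beta>" shows "continuous_on UNIV (dyadic_sum \<beta>)"
proof (rule uniform_limit_theorem)
  show "\<forall>\<^sub>F n in sequentially. continuous_on UNIV (\<lambda>z. \<Sum>k<n. dyadic_term \<beta> k z)"
    by (intro always_eventually allI continuous_on_sum continuous_dyadic_term assms)
  show "uniform_limit UNIV (\<lambda>n z. \<Sum>k<n. dyadic_term \<beta> k z) (dyadic_sum \<beta>) sequentially"
  proof (rule uniform_limitI)
    fix e :: real assume "0 < e"
    have "(\<lambda>n. B * inverse (real (Suc n))) \<longlonglongrightarrow> 0"
      by (rule tendsto_mult_right_zero[OF LIMSEQ_inverse_real_of_nat])
    then have "\<forall>\<^sub>F n in sequentially. B * inverse (real (Suc n)) < e"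
      using order_tendstoD(2) \<open>0 < e\<close> by blast
    then show "\<forall>\<^sub>F n in sequentially. \<forall>z\<in>UNIV. dist (\<Sum>k<n. dyadic_term \<beta> k z) (dyadic_sum \<beta> z) < e"
    proof eventually_elim
      case (elim n)
      then show ?case
        using dyadic_remainder(1,2)[of _ n] by (auto simp: dist_real_def abs_minus_commute intro: le_less_trans)
    qed
  qed
qed auto

end

section \<open>Testing against rescaled bumps\<close>

lemma sign_kernel_uminus: "sign_kernel (- x) = - sign_kernel x"
  by (simp add: sign_kernel_def)

lemma norm_sign_kernel_le: "norm (sign_kernel x) \<le> 1"
  by (cases "x = 0") (simp_all add: sign_kernel_def)

lemma sign_kernel_scale: "t > 0 \<Longrightarrow> sign_kernel (t *\<^sub>R x) = sign_kernel x"
  by (cases "x = 0") (simp_all add: sign_kernel_def)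

text \<open>
  The transpose of convolution with the kernel, which acts on test functions.
\<close>
definition sign_correlation :: "(real ^ 'n::finite \<Rightarrow> real) \<Rightarrow> real ^ 'n \<Rightarrow> real ^ 'n" where
  "sign_correlation g z = (\<integral>x. g x *\<^sub>R sign_kernel (x - z) \<partial>lborel)"

lemma corr_eq_conv: "sign_correlation g z = - convolution g sign_kernel z"
proof -
  have "g x *\<^sub>R sign_kernel (x - z) = - (g x *\<^sub>R sign_kernel (z - x))" for x
    using sign_kernel_uminus[of "z - x"] by simp
  then show ?thesis by (simp add: sign_correlation_def convolution_def)
qed

lemma locally_integrable_sign_kernel: "locally_integrable (sign_kernel :: real ^ 'n::finite \<Rightarrow> _)"
  by (rule smooth_homogeneous_locally_integrable[OF smooth_homogeneous_sign_kernel]) simp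

lemma measurable_sign_kernel [measurable]: "sign_kernel \<in> borel_measurable borel"
  by (rule conjunct1[OF locally_integrable_sign_kernel[unfolded locally_integrable_def]])

lemma continuous_corr:
  assumes "continuous_on UNIV g" "\<And>x. g x \<noteq> 0 \<Longrightarrow> norm x \<le> R"
  shows "continuous_on A (sign_correlation g)"
proof -
  have "continuous_on UNIV (\<lambda>z. - convolution g sign_kernel z)"
    by (intro continuous_on_minus conv_continuous[OF assms locally_integrable_sign_kernel])
  then show ?thesis
    unfolding corr_eq_conv[abs_def] by (rule continuous_on_subset[OF _ subset_UNIV])
qed

lemma norm_corr_le:
  assumes "integrable lborel g"
  shows "norm (sign_correlation g z) \<le> (\<integral>x. \<bar>g x\<bar> \<partial>lborel)"
proof -
  have [measurable]: "g \<in> borel_measurable borel" using assms by auto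
  have bound: "norm (g x *\<^sub>R sign_kernel (x - z)) \<le> \<bar>g x\<bar>" for x
    using norm_sign_kernel_le[of "x - z"] mult_left_mono[of "norm (sign_kernel (x - z))" 1 "\<bar>g x\<bar>"] by simp
  have int: "integrable lborel (\<lambda>x. g x *\<^sub>R sign_kernel (x - z))"
    by (rule Bochner_Integration.integrable_bound[OF assms]) (use bound in auto)
  have "norm (sign_correlation g z) \<le> (\<integral>x. norm (g x *\<^sub>R sign_kernel (x - z)) \<partial>lborel)"
    unfolding sign_correlation_def by (rule integral_norm_bound)
  also have "\<dots> \<le> (\<integral>x. \<bar>g x\<bar> \<partial>lborel)"
    by (intro integral_mono integrable_norm int integrable_abs assms bound)
  finally show ?thesis .
qed

lemma conv_corr_adjoint:
  assumes "integrable lborel f" "integrable lborel g"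
  shows "(\<integral>x. g x *\<^sub>R convolution f sign_kernel x \<partial>lborel) = (\<integral>z. f z *\<^sub>R sign_correlation g z \<partial>lborel)"
proof -
  have [measurable]: "f \<in> borel_measurable borel" "g \<in> borel_measurable borel" using assms by auto
  let ?\<Phi> = "\<lambda>z x. (f z * g x) *\<^sub>R sign_kernel (x - z)"
  have "integrable (lborel \<Otimes>\<^sub>M lborel) (\<lambda>(z, x). f z * g x)"
    by (rule lborel_pair.Fubini_integrable) (use assms in \<open>auto simp: abs_mult\<close>)
  then have int: "integrable (lborel \<Otimes>\<^sub>M lborel) (case_prod ?\<Phi>)"
  proof (rule Bochner_Integration.integrable_bound)
    show "AE p in lborel \<Otimes>\<^sub>M lborel. norm (case_prod ?\<Phi> p) \<le> norm (case p of (z, x) \<Rightarrow> f z * g x)"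
    proof (rule AE_I2)
      fix p
      show "norm (case_prod ?\<Phi> p) \<le> norm (case p of (z, x) \<Rightarrow> f z * g x)"
        using mult_left_mono[OF norm_sign_kernel_le, of "\<bar>f (fst p) * g (snd p)\<bar>"]
        by (simp add: split_beta)
    qed
  qed (simp add: split_beta')
  have "(\<integral>x. g x *\<^sub>R convolution f sign_kernel x \<partial>lborel) = (\<integral>x. (\<integral>z. ?\<Phi> z x \<partial>lborel) \<partial>lborel)"
  proof -
    have "?\<Phi> z x = g x *\<^sub>R (f z *\<^sub>R sign_kernel (x - z))" for z x by (simp add: mult.commute)
    then show ?thesis by (simp only: convolution_def integral_scaleR_right)
  qed
  also have "\<dots> = (\<integral>z. (\<integral>x. ?\<Phi> z x \<partial>lborel) \<partial>lborel)"
    by (rule lborel_pair.Fubini_integral[OF int])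
  also have "\<dots> = (\<integral>z. f z *\<^sub>R sign_correlation g z \<partial>lborel)"
    by (simp add: sign_correlation_def flip: integral_scaleR_right scaleR_scaleR)
  finally show ?thesis .
qed

text \<open>
  The kernel is invariant under dilations, so the Jacobian cancels exactly the factor produced by a
  derivative of order \<open>d\<close> (see \<open>foldr_partial_affine\<close>).
\<close>
lemma corr_rescale:
  fixes g :: "real ^ 'n::finite \<Rightarrow> real"
  assumes "t > 0" and [measurable]: "g \<in> borel_measurable borel"
  shows "sign_correlation (\<lambda>x. t ^ CARD('n) * g (t *\<^sub>R x + (- t) *\<^sub>R x0)) z = sign_correlation g (t *\<^sub>R (z - x0))"
proof -
  have K: "sign_kernel (t *\<^sub>R x + (- t) *\<^sub>R x0 - t *\<^sub>R (z - x0)) = sign_kernel (x - z)" for x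
    using sign_kernel_scale[OF assms(1), of "x - z"] by (simp add: algebra_simps)
  have "sign_correlation g (t *\<^sub>R (z - x0)) = \<bar>t\<bar> ^ CARD('n) *\<^sub>R (\<integral>x. g (t *\<^sub>R x + (- t) *\<^sub>R x0) *\<^sub>R
      sign_kernel (t *\<^sub>R x + (- t) *\<^sub>R x0 - t *\<^sub>R (z - x0)) \<partial>lborel)"
    unfolding sign_correlation_def using assms(1)
    by (subst integral_affine[of t _ "(- t) *\<^sub>R x0"]) auto
  then show ?thesis
    unfolding K sign_correlation_def using assms(1) by (simp flip: integral_scaleR_right scaleR_scaleR)
qed

text \<open>
  Away from the support of \<open>\<phi>\<close> the kernel is smooth, so all derivatives can be moved onto it.
\<close>
lemma corr_derivative_far:
  fixes \<phi> :: "real ^ 'n::finite \<Rightarrow> real"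
  assumes "\<And>k. \<phi> \<in> C_k k UNIV" "\<And>x. \<phi> x \<noteq> 0 \<Longrightarrow> norm x \<le> \<epsilon>" "\<epsilon> < norm z"
  shows "sign_correlation (foldr partial_deriv is \<phi>) z
    = (-1) ^ length is *\<^sub>R (\<integral>x. \<phi> x *\<^sub>R foldr partial_deriv (rev is) sign_kernel (x - z) \<partial>lborel)"
    and "integrable lborel (\<lambda>x. \<phi> x *\<^sub>R foldr partial_deriv (rev is) sign_kernel (x - z))"
proof -
  let ?S = "- {z}" and ?K = "\<lambda>x. sign_kernel (1 *\<^sub>R x + (- z))"
  have S: "{x. 1 *\<^sub>R x + (- z) \<in> - {0}} = ?S" by auto
  have "closure {x. \<phi> x \<noteq> 0} \<subseteq> cball 0 \<epsilon>"
    by (rule closure_minimal) (use assms(2) in auto)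
  then have test: "\<phi> \<in> test_functions ?S"
    using assms(1,3) compact_Int_closed[of "cball 0 \<epsilon>" "closure {x. \<phi> x \<noteq> 0}"]
    by (auto simp: test_functions_def compact_support_in_def Int_absorb1)
  have Ck: "?K \<in> C_k (length is) ?S"
    using C_k_affine[OF _ sign_kernel_C_k, of 1 "- z"] unfolding S by (simp add: open_Compl)
  have foldr: "foldr partial_deriv (rev is) ?K x = foldr partial_deriv (rev is) sign_kernel (x - z)"
    if "x \<in> ?S" for x
    using foldr_partial_affine[OF _ sign_kernel_C_k, of 1 x "- z" "rev is"] that
    by (simp add: open_Compl)
  have eq: "\<phi> x *\<^sub>R foldr partial_deriv (rev is) ?K x
      = \<phi> x *\<^sub>R foldr partial_deriv (rev is) sign_kernel (x - z)" for x
    using foldr[of x] test_functions_outside[OF test, of x] by (cases "x = z") auto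
  show "sign_correlation (foldr partial_deriv is \<phi>) z
    = (-1) ^ length is *\<^sub>R (\<integral>x. \<phi> x *\<^sub>R foldr partial_deriv (rev is) sign_kernel (x - z) \<partial>lborel)"
    using iterated_integration_by_parts[OF _ test Ck] unfolding eq
    by (simp add: sign_correlation_def open_Compl)
  have "foldr partial_deriv (rev is) ?K \<in> C_k 0 ?S"
    by (rule C_k_foldr) (use Ck in simp)
  from test_functions_scaleR_integrable[OF _ test C_k_continuous_on[OF this]]
  show "integrable lborel (\<lambda>x. \<phi> x *\<^sub>R foldr partial_deriv (rev is) sign_kernel (x - z))"
    unfolding eq by (simp add: open_Compl)
qed

text \<open>
  In \<open>corr_derivative_far\<close> the kernel derivative is evaluated at \<open>x - t *\<^sub>R w = t *\<^sub>R (x /\<^sub>R t - w)\<close>.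
  Homogeneity extracts the power of \<open>t\<close>, and \<open>x /\<^sub>R t - w\<close> stays in the ball around \<open>v\<close> on which the
  derivative has a positive component in direction \<open>q\<close>.
\<close>
lemma corr_derivative_lower_bound:
  fixes \<phi> :: "real ^ 'n::finite \<Rightarrow> real"
  assumes \<phi>: "\<And>k. \<phi> \<in> C_k k UNIV" "\<And>x. \<phi> x \<noteq> 0 \<Longrightarrow> norm x \<le> \<epsilon>" "\<And>x. 0 \<le> \<phi> x"
    and v: "2 * \<epsilon> < norm v" and w: "norm (w + v) \<le> \<epsilon>"
    and pos: "\<And>u. norm (u - v) \<le> 2 * \<epsilon> \<Longrightarrow> c \<le> foldr partial_deriv (rev is) sign_kernel u \<bullet> q"
    and t: "t \<ge> 1"
  shows "inverse t ^ length is * (c * integral\<^sup>L lborel \<phi>)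
    \<le> sign_correlation (foldr partial_deriv is \<phi>) (t *\<^sub>R w) \<bullet> ((-1) ^ length is *\<^sub>R q)"
proof -
  let ?D = "foldr partial_deriv (rev is) (sign_kernel :: real ^ 'n \<Rightarrow> real ^ 'n)" and ?m = "length is"
  have "norm v \<le> norm (w + v) + norm w" using norm_triangle_ineq4[of "w + v" w] by simp
  then have nw: "\<epsilon> < norm w" using v w by linarith
  also have "norm w \<le> norm (t *\<^sub>R w)" using t mult_right_mono[of 1 t "norm w"] by simp
  finally have far: "\<epsilon> < norm (t *\<^sub>R w)" .
  have hom: "smooth_homogeneous ?m ?D"
    using smooth_homogeneous_foldr[OF smooth_homogeneous_sign_kernel, of "rev is"] by simp
  have cd: "sign_correlation (foldr partial_deriv is \<phi>) (t *\<^sub>R w)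
      = (-1) ^ ?m *\<^sub>R (\<integral>x. \<phi> x *\<^sub>R ?D (x - t *\<^sub>R w) \<partial>lborel)"
    "integrable lborel (\<lambda>x. \<phi> x *\<^sub>R ?D (x - t *\<^sub>R w))"
    using corr_derivative_far[OF \<phi>(1,2) far] by blast+
  have pt: "inverse t ^ ?m * c * \<phi> x \<le> (\<phi> x *\<^sub>R ?D (x - t *\<^sub>R w)) \<bullet> q" for x
  proof (cases "\<phi> x = 0")
    case False
    let ?u = "x /\<^sub>R t - w"
    have "norm (x /\<^sub>R t) \<le> norm x"
      using t mult_right_mono[of 1 t "norm x"] by (simp add: field_simps)
    then have "norm (x /\<^sub>R t) \<le> \<epsilon>" using \<phi>(2)[OF False] by linarith
    moreover have "norm (?u - v) \<le> norm (x /\<^sub>R t) + norm (w + v)"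
      using norm_triangle_ineq4[of "x /\<^sub>R t" "w + v"] by (simp add: algebra_simps)
    ultimately have u: "norm (?u - v) \<le> 2 * \<epsilon>" using w by linarith
    have "?u \<noteq> 0" using u v by auto
    then have "?D (t *\<^sub>R ?u) = inverse t ^ ?m *\<^sub>R ?D ?u"
      using hom t by (simp add: smooth_homogeneous_def)
    moreover have "t *\<^sub>R ?u = x - t *\<^sub>R w" using t by (simp add: scaleR_diff_right)
    ultimately have "(\<phi> x *\<^sub>R ?D (x - t *\<^sub>R w)) \<bullet> q = (inverse t ^ ?m * \<phi> x) * (?D ?u \<bullet> q)"
      by simp
    moreover have "(inverse t ^ ?m * \<phi> x) * c \<le> (inverse t ^ ?m * \<phi> x) * (?D ?u \<bullet> q)"
      using pos[OF u] \<phi>(3) t by (intro mult_left_mono) auto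
    ultimately show ?thesis by (simp only: mult_ac)
  qed simp
  have int\<phi>: "integrable lborel \<phi>"
    using C_k_continuous_on[OF \<phi>(1)] \<phi>(2) by (rule compactly_supported_integrable)
  have "inverse t ^ ?m * (c * integral\<^sup>L lborel \<phi>) = (\<integral>x. inverse t ^ ?m * c * \<phi> x \<partial>lborel)" by simp
  also have "\<dots> \<le> (\<integral>x. (\<phi> x *\<^sub>R ?D (x - t *\<^sub>R w)) \<bullet> q \<partial>lborel)"
    by (intro integral_mono integrable_mult_right int\<phi> integrable_inner_left cd(2) pt)
  also have "\<dots> = (\<integral>x. \<phi> x *\<^sub>R ?D (x - t *\<^sub>R w) \<partial>lborel) \<bullet> q"
    by (rule integral_inner_left) (rule cd(2))
  also have "\<dots> = sign_correlation (foldr partial_deriv is \<phi>) (t *\<^sub>R w) \<bullet> ((-1) ^ ?m *\<^sub>R q)"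
    by (simp only: cd(1)) (simp flip: power_mult_distrib mult.assoc)
  finally show ?thesis .
qed

text \<open>
  After the substitution \<open>w = 2 ^ N *\<^sub>R z\<close>, the \<open>k\<close>-th shell is dilated by \<open>2 ^ (N - k)\<close>. For
  \<open>k \<le> N\<close> the volume growth of the dilated shell cancels the decay of \<open>L\<close>, so the shell contributes at
  least a fixed multiple of \<open>1 / (k + 1)\<close>; the shells with \<open>k > N\<close> end up in a fixed ball, where only the
  boundedness of \<open>L\<close> is used.
\<close>
lemma dyadic_pairing_lower_bound:
  fixes \<beta> L :: "'a::euclidean_space \<Rightarrow> real"
  assumes cont: "continuous_on UNIV \<beta>" and nonneg: "\<And>w. 0 \<le> \<beta> w" and bound: "\<And>w. \<beta> w \<le> B"
    and annulus: "\<And>w. \<beta> w \<noteq> 0 \<Longrightarrow> \<rho> < norm w \<and> norm w < 2 * \<rho>"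
    and contL: "continuous_on UNIV L" and boundL: "\<And>w. \<bar>L w\<bar> \<le> M"
    and lower: "\<And>w t. \<beta> w \<noteq> 0 \<Longrightarrow> t \<ge> 1 \<Longrightarrow> inverse t ^ DIM('a) * c \<le> L (t *\<^sub>R w)"
  shows "inverse (2 ^ N) ^ DIM('a) * (c * integral\<^sup>L lborel \<beta> * (\<Sum>k<Suc N. inverse (real (Suc k)))
      - B * M * measure lborel (ball 0 (2 * \<rho>) :: 'a set))
    \<le> (\<integral>z. dyadic_sum \<beta> z * L (2 ^ N *\<^sub>R z) \<partial>lborel)"
proof -
  let ?t = "inverse (2 ^ N) :: real" and ?V = "measure lborel (ball 0 (2 * \<rho>) :: 'a set)"
  define T where "T k w = dyadic_term \<beta> k (?t *\<^sub>R w) * L w" for k w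
  define E where "E w = (dyadic_sum \<beta> (?t *\<^sub>R w) - (\<Sum>k<Suc N. dyadic_term \<beta> k (?t *\<^sub>R w))) * L w" for w
  note rem = dyadic_remainder[OF nonneg bound annulus]
  have [measurable]: "\<beta> \<in> borel_measurable borel" "L \<in> borel_measurable borel"
    "dyadic_sum \<beta> \<in> borel_measurable borel"
    using cont contL continuous_dyadic_sum[OF nonneg bound annulus cont]
    by (auto intro: borel_measurable_continuous_onI)
  have "B \<ge> 0" using nonneg[of 0] bound[of 0] by linarith
  have "M \<ge> 0" using boundL[of 0] by linarith
  have int\<beta>: "integrable lborel \<beta>"
    by (rule compactly_supported_integrable[OF cont, where R = "2 * \<rho>"]) (meson annulus less_imp_le)
  have intT: "integrable lborel (T k)" for k
  proof (rule compactly_supported_integrable[where R = "2 * \<rho> * 2 ^ N / 2 ^ k"])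
    show "continuous_on UNIV (T k)"
      unfolding T_def[abs_def]
      by (intro continuous_intros contL continuous_on_compose2[OF continuous_dyadic_term[OF cont]]) auto
    show "norm w \<le> 2 * \<rho> * 2 ^ N / 2 ^ k" if "T k w \<noteq> 0" for w
    proof -
      have "norm (2 ^ k *\<^sub>R ?t *\<^sub>R w) < 2 * \<rho>"
        using annulus[of "2 ^ k *\<^sub>R ?t *\<^sub>R w"] that by (auto simp: T_def dyadic_term_def)
      then show ?thesis by (simp add: field_simps)
    qed
  qed
  have T: "c * integral\<^sup>L lborel \<beta> * inverse (real (Suc k)) \<le> integral\<^sup>L lborel (T k)" if "k < Suc N" for k
  proof -
    let ?s = "2 ^ (N - k) :: real"
    have s: "?s \<ge> 1" "2 ^ k * ?t * ?s = 1" using that by (auto simp: field_simps simp flip: power_add)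
    have "integral\<^sup>L lborel (T k) = ?s ^ DIM('a) * (\<integral>w. inverse (real (Suc k)) * (\<beta> w * L (?s *\<^sub>R w)) \<partial>lborel)"
    proof -
      have "T k (?s *\<^sub>R w) = inverse (real (Suc k)) * (\<beta> w * L (?s *\<^sub>R w))" for w
        using s by (simp add: T_def dyadic_term_def mult.assoc del: of_nat_Suc)
      then show ?thesis
        using integral_affine[of ?s "T k" 0] borel_measurable_integrable[OF intT] s(1) by simp
    qed
    moreover have "inverse ?s ^ DIM('a) * c * integral\<^sup>L lborel \<beta> \<le> (\<integral>w. \<beta> w * L (?s *\<^sub>R w) \<partial>lborel)"
    proof -
      have "(\<integral>w. inverse ?s ^ DIM('a) * c * \<beta> w \<partial>lborel) \<le> (\<integral>w. \<beta> w * L (?s *\<^sub>R w) \<partial>lborel)"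
      proof (rule integral_mono)
        show "integrable lborel (\<lambda>w. \<beta> w * L (?s *\<^sub>R w))"
          by (rule compactly_supported_integrable[where R = "2 * \<rho>"])
            (auto intro!: continuous_intros cont continuous_on_compose2[OF contL]
              less_imp_le[OF conjunct2[OF annulus]])
        show "inverse ?s ^ DIM('a) * c * \<beta> w \<le> \<beta> w * L (?s *\<^sub>R w)" for w
          using lower[OF _ s(1), of w] nonneg[of w] mult_left_mono[of "inverse ?s ^ DIM('a) * c" "L (?s *\<^sub>R w)" "\<beta> w"]
          by (cases "\<beta> w = 0") (auto simp: mult_ac)
      qed (intro integrable_mult_right int\<beta>)
      then show ?thesis by simp
    qed
    then have "?s ^ DIM('a) * (inverse (real (Suc k)) * (inverse ?s ^ DIM('a) * c * integral\<^sup>L lborel \<beta>))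
        \<le> ?s ^ DIM('a) * (inverse (real (Suc k)) * (\<integral>w. \<beta> w * L (?s *\<^sub>R w) \<partial>lborel))"
      by (intro mult_left_mono) auto
    moreover have "?s ^ DIM('a) * (inverse (real (Suc k)) * (inverse ?s ^ DIM('a) * c * integral\<^sup>L lborel \<beta>))
        = c * integral\<^sup>L lborel \<beta> * inverse (real (Suc k))"
    proof -
      have one: "?s ^ DIM('a) * inverse ?s ^ DIM('a) = 1"
        by (simp flip: power_mult_distrib)
      have "a * (x * (b * c * y)) = (a * b) * (c * y * x)" for a b x y :: real
        by (simp only: mult_ac)
      then show ?thesis by (simp only: one mult_1)
    qed
    ultimately show ?thesis by (simp only: integral_mult_right_zero)
  qed
  have E: "\<bar>E w\<bar> \<le> B * M * indicator (ball 0 (2 * \<rho>)) w" for w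
  proof (cases "E w = 0")
    case True
    then show ?thesis using \<open>B \<ge> 0\<close> \<open>M \<ge> 0\<close> by simp
  next
    case False
    let ?r = "dyadic_sum \<beta> (?t *\<^sub>R w) - (\<Sum>k<Suc N. dyadic_term \<beta> k (?t *\<^sub>R w))"
    have "?r \<noteq> 0" using False by (auto simp: E_def)
    then have "norm (?t *\<^sub>R w) < 2 * \<rho> / 2 ^ Suc N" by (rule rem(3)[rotated])
    then have "norm w < \<rho>" by (simp add: field_simps)
    then have "norm w < 2 * \<rho>" using norm_ge_zero[of w] by linarith
    then have w: "w \<in> ball 0 (2 * \<rho>)" by simp
    have "?r \<le> B * inverse (real (Suc (Suc N)))" by (rule rem(2))
    also have "\<dots> \<le> B * 1" using \<open>B \<ge> 0\<close> by (intro mult_left_mono) (auto simp: field_simps)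
    finally have "\<bar>?r\<bar> * \<bar>L w\<bar> \<le> B * M"
      using rem(1)[where z = "?t *\<^sub>R w" and n = "Suc N"] boundL[of w] \<open>B \<ge> 0\<close> by (intro mult_mono) auto
    then show ?thesis using w by (simp add: E_def abs_mult)
  qed
  have intind: "integrable lborel (\<lambda>w :: 'a. B * M * indicator (ball 0 (2 * \<rho>)) w)"
    by (intro integrable_mult_right integrable_real_indicator)
      (use emeasure_lborel_ball_finite[of "0 :: 'a" "2 * \<rho>"] in auto)
  have intE: "integrable lborel E"
  proof (rule Bochner_Integration.integrable_bound[OF intind])
    show "E \<in> borel_measurable lborel"
      unfolding E_def[abs_def] dyadic_term_def by measurable
    show "AE w in lborel. norm (E w) \<le> norm (B * M * indicator (ball 0 (2 * \<rho>)) w)"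
      using E \<open>B \<ge> 0\<close> \<open>M \<ge> 0\<close> by (auto simp: abs_mult)
  qed
  have "\<bar>integral\<^sup>L lborel E\<bar> \<le> (\<integral>w. \<bar>E w\<bar> \<partial>lborel)" by (rule integral_abs_bound)
  also have "\<dots> \<le> (\<integral>w. B * M * indicator (ball 0 (2 * \<rho>)) w \<partial>(lborel :: 'a measure))"
    by (intro integral_mono integrable_abs intE intind E)
  also have "\<dots> = B * M * ?V" by simp
  finally have E': "- (B * M * ?V) \<le> integral\<^sup>L lborel E" by simp
  have "(\<integral>z. dyadic_sum \<beta> z * L (2 ^ N *\<^sub>R z) \<partial>lborel)
      = ?t ^ DIM('a) * (\<integral>w. (\<Sum>k<Suc N. T k w) + E w \<partial>lborel)"
  proof -
    have "(\<Sum>k<Suc N. T k w) + E w = dyadic_sum \<beta> (?t *\<^sub>R w) * L w" for w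
      by (simp only: T_def E_def sum_distrib_right[symmetric]) (simp only: algebra_simps)
    then show ?thesis
      by (subst integral_affine[of ?t _ 0]) auto
  qed
  also have "(\<integral>w. (\<Sum>k<Suc N. T k w) + E w \<partial>lborel) = (\<Sum>k<Suc N. integral\<^sup>L lborel (T k)) + integral\<^sup>L lborel E"
    using intT intE by (simp only: Bochner_Integration.integral_add Bochner_Integration.integral_sum
        Bochner_Integration.integrable_sum)
  finally have eq: "(\<integral>z. dyadic_sum \<beta> z * L (2 ^ N *\<^sub>R z) \<partial>lborel)
      = ?t ^ DIM('a) * ((\<Sum>k<Suc N. integral\<^sup>L lborel (T k)) + integral\<^sup>L lborel E)" .
  have "c * integral\<^sup>L lborel \<beta> * (\<Sum>k<Suc N. inverse (real (Suc k))) \<le> (\<Sum>k<Suc N. integral\<^sup>L lborel (T k))"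
    unfolding sum_distrib_left by (intro sum_mono T) auto
  then show ?thesis
    unfolding eq using E' by (intro mult_left_mono) auto
qed

text \<open>
  The pairing of \<open>\<partial>\<^sup>\<alpha> \<psi>\<close> with the convolution cannot be bounded by \<open>C\<close> times the integral
  of \<open>\<psi>\<close>, even for nonnegative \<open>\<psi>\<close> supported in a fixed ball. All estimates are made
  for the inner product with \<open>p\<close>, which is up to sign the value of the kernel derivative at \<open>v\<close>.
\<close>
lemma unbounded_derivative_functional:
  fixes x0 :: "real ^ 'n::finite"
  assumes card: "CARD('n) \<ge> 2" and len: "length is = CARD('n)" and "R > 0"
  obtains f :: "real ^ 'n \<Rightarrow> real" where
    "continuous_on UNIV f" "\<And>x. 0 \<le> f x" "\<And>x. f x \<noteq> 0 \<Longrightarrow> norm (x - x0) \<le> R"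
    "integrable lborel f" "integral\<^sup>L lborel f = 1"
    "\<And>C. \<exists>\<psi>. (\<forall>k. \<psi> \<in> C_k k UNIV) \<and> (\<forall>x. 0 \<le> \<psi> x) \<and> (\<forall>x. \<psi> x \<noteq> 0 \<longrightarrow> norm (x - x0) \<le> R) \<and>
      C * integral\<^sup>L lborel \<psi> < norm (\<integral>x. foldr partial_deriv is \<psi> x *\<^sub>R convolution f sign_kernel x \<partial>lborel)"
proof -
  let ?d = "CARD('n)"
  define D :: "real ^ 'n \<Rightarrow> real ^ 'n" where "D = foldr partial_deriv (rev is) sign_kernel"
  have hom: "smooth_homogeneous ?d D"
    using smooth_homogeneous_foldr[OF smooth_homogeneous_sign_kernel, of "rev is"] len by (simp add: D_def)
  obtain v0 where v0: "v0 \<noteq> 0" "D v0 \<noteq> 0"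
    using iterated_partial_sign_kernel_nonzero[OF card, of "rev is"] by (auto simp: D_def)
  \<comment> \<open>By homogeneity \<open>v0\<close> may be rescaled; with norm \<open>3 * R / 4\<close> and \<open>\<epsilon> \<le> R / 8\<close> the support of \<open>\<beta>\<close>
    lies in the annulus \<open>R / 2 < norm w < R\<close>.\<close>
  define v where "v = (3 * R / 4 / norm v0) *\<^sub>R v0"
  have nv: "norm v = 3 * R / 4" using v0 \<open>R > 0\<close> by (simp add: v_def)
  then have "v \<noteq> 0" using \<open>R > 0\<close> by auto
  define q where "q = D v"
  have "D v = inverse (3 * R / 4 / norm v0) ^ ?d *\<^sub>R D v0"
    unfolding v_def using hom v0(1) \<open>R > 0\<close> by (simp add: smooth_homogeneous_def)
  then have "q \<noteq> 0" using v0 \<open>R > 0\<close> by (simp add: q_def)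
  define c where "c = q \<bullet> q / 2"
  have "c > 0" using \<open>q \<noteq> 0\<close> by (simp add: c_def)
  have "isCont (\<lambda>u. D u \<bullet> q) v"
  proof -
    have "isCont D v"
      using smooth_homogeneous_continuous[OF hom] \<open>v \<noteq> 0\<close>
      by (simp add: continuous_on_eq_continuous_at open_Compl)
    then show ?thesis by (intro continuous_intros)
  qed
  then obtain \<delta> where \<delta>: "\<delta> > 0" "\<And>u. dist u v < \<delta> \<Longrightarrow> dist (D u \<bullet> q) (D v \<bullet> q) < c"
    using \<open>c > 0\<close> by (auto simp: continuous_at_eps_delta)
  have Dpos: "c \<le> D u \<bullet> q" if "dist u v < \<delta>" for u
  proof -
    have "D v \<bullet> q = 2 * c" by (simp add: c_def q_def)
    then show ?thesis using \<delta>(2)[OF that] unfolding dist_real_def by linarith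
  qed
  define \<epsilon> where "\<epsilon> = min (\<delta> / 3) (R / 8)"
  have \<epsilon>: "0 < \<epsilon>" "2 * \<epsilon> < \<delta>" "\<epsilon> \<le> R / 8" using \<delta>(1) \<open>R > 0\<close> by (auto simp: \<epsilon>_def)

  define \<phi> where "\<phi> = (\<lambda>x :: real ^ 'n. bump ((1 / \<epsilon>) *\<^sub>R x + 0))"
  have \<phi>Ck: "\<phi> \<in> C_k k UNIV" for k
    using C_k_affine[OF open_UNIV bump_C_k, of "1 / \<epsilon>" 0 k] by (simp add: \<phi>_def)
  have \<phi>supp: "norm x \<le> \<epsilon>" if "\<phi> x \<noteq> 0" for x
    using that \<epsilon>(1) by (simp add: \<phi>_def bump_pos_iff field_simps)
  have \<phi>nonneg: "0 \<le> \<phi> x" for x by (simp add: \<phi>_def bump_nonneg)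
  have \<phi>cont: "continuous_on UNIV \<phi>" using C_k_continuous_on[OF \<phi>Ck] .
  have \<phi>int: "integrable lborel \<phi>" by (rule compactly_supported_integrable[OF \<phi>cont \<phi>supp])
  have \<phi>meas [measurable]: "\<phi> \<in> borel_measurable borel" using \<phi>int by auto
  define I\<phi> where "I\<phi> = integral\<^sup>L lborel \<phi>"
  have I\<phi>: "I\<phi> > 0"
    unfolding I\<phi>_def
    by (rule integral_pos_continuous[OF \<phi>cont \<phi>int \<phi>nonneg, of 0]) (simp add: \<phi>_def bump_pos_iff)

  define \<beta> where "\<beta> w = max 0 (\<epsilon> - norm (w + v))" for w
  have \<beta>: "continuous_on UNIV \<beta>" "\<And>w. 0 \<le> \<beta> w" "\<And>w. \<beta> w \<le> \<epsilon>"
    using \<epsilon>(1) by (auto simp: \<beta>_def[abs_def] intro!: continuous_intros)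
  have \<beta>supp: "norm (w + v) \<le> \<epsilon>" if "\<beta> w \<noteq> 0" for w using that by (auto simp: \<beta>_def max_def split: if_splits)
  have \<beta>ann: "R / 2 < norm w \<and> norm w < 2 * (R / 2)" if "\<beta> w \<noteq> 0" for w
  proof -
    have "norm v \<le> norm (w + v) + norm w" using norm_triangle_ineq4[of "w + v" w] by simp
    moreover have "norm w \<le> norm (w + v) + norm v" using norm_triangle_ineq4[of "w + v" v] by simp
    ultimately show ?thesis using \<beta>supp[OF that] nv \<epsilon>(3) \<open>R > 0\<close> by auto
  qed
  have \<beta>int: "integrable lborel \<beta>"
    by (rule compactly_supported_integrable[OF \<beta>(1), where R = R]) (use \<beta>ann in fastforce)
  define I\<beta> where "I\<beta> = integral\<^sup>L lborel \<beta>"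
  have I\<beta>: "I\<beta> > 0"
    unfolding I\<beta>_def
    by (rule integral_pos_continuous[OF \<beta>(1) \<beta>int \<beta>(2), of "- v"]) (use \<epsilon>(1) in \<open>simp add: \<beta>_def\<close>)

  define f0 where "f0 = dyadic_sum \<beta>"
  have f0cont: "continuous_on UNIV f0" unfolding f0_def by (rule continuous_dyadic_sum[OF \<beta>(2,3) \<beta>ann \<beta>(1)])
  have f0nonneg: "0 \<le> f0 z" for z unfolding f0_def by (rule dyadic_sum_nonneg[OF \<beta>(2,3) \<beta>ann])
  have f0supp: "norm z \<le> R" if "f0 z \<noteq> 0" for z
    using dyadic_sum_support[where \<beta> = \<beta> and z = z, OF \<beta>(2,3) \<beta>ann] that by (simp add: f0_def)
  have f0int: "integrable lborel f0" by (rule compactly_supported_integrable[OF f0cont f0supp])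
  have [measurable]: "f0 \<in> borel_measurable borel" using f0int by auto
  define I0 where "I0 = integral\<^sup>L lborel f0"
  have I0: "I0 > 0"
    unfolding I0_def
  proof (rule integral_pos_continuous[OF f0cont f0int f0nonneg])
    have "\<beta> (- v) \<le> f0 (- v)" unfolding f0_def by (rule dyadic_sum_ge[OF \<beta>(2,3) \<beta>ann])
    then show "f0 (- v) \<noteq> 0" using \<epsilon>(1) by (simp add: \<beta>_def)
  qed
  define f where "f z = f0 (z - x0) / I0" for z
  have fcont: "continuous_on UNIV f"
    unfolding f_def[abs_def] using I0
    by (intro continuous_intros continuous_on_compose2[OF f0cont]) auto
  have fsupp: "norm (z - x0) \<le> R" if "f z \<noteq> 0" for z using that f0supp by (auto simp: f_def)
  have fsupp': "norm z \<le> norm x0 + R" if "f z \<noteq> 0" for z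
    using fsupp[OF that] norm_triangle_ineq2[of z x0] by linarith
  have fint: "integrable lborel f" by (rule compactly_supported_integrable[OF fcont fsupp'])
  have "integral\<^sup>L lborel f = 1"
    using integral_affine[of 1 f0 "- x0"] I0 by (simp add: f_def[abs_def] I0_def)

  define g where "g = foldr partial_deriv is \<phi>"
  have test: "\<phi> \<in> test_functions UNIV"
  proof -
    have "closure {x. \<phi> x \<noteq> 0} \<subseteq> cball 0 \<epsilon>"
      by (rule closure_minimal) (use \<phi>supp in auto)
    then show ?thesis
      using \<phi>Ck compact_Int_closed[of "cball 0 \<epsilon>" "closure {x. \<phi> x \<noteq> 0}"]
      by (auto simp: test_functions_def compact_support_in_def Int_absorb1)
  qed
  then have gtest: "g \<in> test_functions UNIV" unfolding g_def by (rule test_functions_foldr)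
  have gcont: "continuous_on UNIV g" by (rule test_functions_continuous[OF gtest])
  obtain Rg where Rg: "\<And>x. g x \<noteq> 0 \<Longrightarrow> norm x \<le> Rg"
    using gtest compact_support_in_cball unfolding test_functions_def by blast
  have gint: "integrable lborel g" by (rule compactly_supported_integrable[OF gcont Rg])
  have [measurable]: "g \<in> borel_measurable borel" using gint by auto
  have corrcont: "continuous_on UNIV (sign_correlation g)" by (rule continuous_corr[OF gcont Rg])
  \<comment> \<open>The sign comes from \<open>d\<close> integrations by parts.\<close>
  define p where "p = (-1) ^ ?d *\<^sub>R q"
  have np: "norm p = norm q" "p \<noteq> 0" using \<open>q \<noteq> 0\<close> by (auto simp: p_def)
  define L where "L w = sign_correlation g w \<bullet> p" for w
  define M where "M = (\<integral>x. \<bar>g x\<bar> \<partial>lborel) * norm p"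
  have Lcont: "continuous_on UNIV L" unfolding L_def[abs_def] by (intro continuous_intros corrcont)
  have LM: "\<bar>L w\<bar> \<le> M" for w
    unfolding L_def M_def
    by (rule order_trans[OF Cauchy_Schwarz_ineq2 mult_right_mono[OF norm_corr_le[OF gint]]]) simp
  have lower: "inverse t ^ DIM(real ^ 'n) * (c * I\<phi>) \<le> L (t *\<^sub>R w)" if "\<beta> w \<noteq> 0" "t \<ge> 1" for w t
  proof -
    have "inverse t ^ length is * (c * integral\<^sup>L lborel \<phi>)
      \<le> sign_correlation (foldr partial_deriv is \<phi>) (t *\<^sub>R w) \<bullet> ((-1) ^ length is *\<^sub>R q)"
    proof (rule corr_derivative_lower_bound[OF \<phi>Ck \<phi>supp \<phi>nonneg _ \<beta>supp[OF that(1)] _ that(2)])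
      show "2 * \<epsilon> < norm v" using nv \<epsilon>(3) \<open>R > 0\<close> by linarith
      show "c \<le> foldr partial_deriv (rev is) sign_kernel u \<bullet> q" if "norm (u - v) \<le> 2 * \<epsilon>" for u
        using Dpos[of u] that \<epsilon>(2) by (simp add: D_def dist_norm)
    qed
    then show ?thesis by (simp add: L_def g_def p_def I\<phi>_def len)
  qed
  define V where "V = \<epsilon> * M * measure lborel (ball 0 (2 * (R / 2)) :: (real ^ 'n) set)"
  have main: "inverse (2 ^ N) ^ ?d * (c * I\<phi> * I\<beta> * (\<Sum>k<Suc N. inverse (real (Suc k))) - V)
      \<le> (\<integral>z. f0 z * L (2 ^ N *\<^sub>R z) \<partial>lborel)" for N
    using dyadic_pairing_lower_bound[OF \<beta> \<beta>ann Lcont LM lower, of N]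
    by (simp add: f0_def I\<beta>_def V_def)

  show ?thesis
  proof (rule that[OF fcont _ fsupp fint \<open>integral\<^sup>L lborel f = 1\<close>])
    show "0 \<le> f x" for x using f0nonneg I0 by (simp add: f_def)
    fix C :: real
    \<comment> \<open>Divergence of the harmonic series provides the scale.\<close>
    obtain N where N: "V + I0 * \<bar>C\<bar> * I\<phi> * norm p < c * I\<phi> * I\<beta> * (\<Sum>k<Suc N. inverse (real (Suc k)))"
    proof -
      have "\<forall>\<^sub>F n in sequentially. (V + I0 * \<bar>C\<bar> * I\<phi> * norm p) / (c * I\<phi> * I\<beta>) < harm n"
        using harm_at_top by (auto simp: filterlim_at_top_dense)
      then obtain n where "\<forall>m\<ge>n. (V + I0 * \<bar>C\<bar> * I\<phi> * norm p) / (c * I\<phi> * I\<beta>) < harm m"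
        by (auto simp: eventually_sequentially)
      then have "(V + I0 * \<bar>C\<bar> * I\<phi> * norm p) / (c * I\<phi> * I\<beta>) < harm (Suc n)" by simp
      moreover have "(harm (Suc n) :: real) = (\<Sum>k<Suc n. inverse (real (Suc k)))"
        unfolding harm_def by (rule sum.reindex_bij_witness[of _ Suc "\<lambda>k. k - 1"]) auto
      ultimately show ?thesis
        using that[of n] \<open>c > 0\<close> I\<phi> I\<beta> by (simp add: pos_divide_less_eq mult.commute)
    qed
    define t :: real where "t = 2 ^ N"
    have t: "t \<ge> 1" by (simp add: t_def)
    define \<psi> where "\<psi> = (\<lambda>x. \<phi> (t *\<^sub>R x + (- t) *\<^sub>R x0))"
    have \<psi>Ck: "\<psi> \<in> C_k k UNIV" for k
      using C_k_affine[OF open_UNIV \<phi>Ck, of t "(- t) *\<^sub>R x0" k] by (simp add: \<psi>_def)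
    have \<psi>supp: "norm (x - x0) \<le> R" if "\<psi> x \<noteq> 0" for x
    proof -
      have "norm (t *\<^sub>R x + (- t) *\<^sub>R x0) \<le> \<epsilon>" using \<phi>supp that by (simp add: \<psi>_def)
      moreover have "t *\<^sub>R x + (- t) *\<^sub>R x0 = t *\<^sub>R (x - x0)" by (simp add: scaleR_diff_right)
      ultimately have "t * norm (x - x0) \<le> \<epsilon>" using t by simp
      moreover have "1 * norm (x - x0) \<le> t * norm (x - x0)" using t by (intro mult_right_mono) auto
      ultimately show ?thesis using \<epsilon>(3) \<open>R > 0\<close> by linarith
    qed
    have I\<psi>: "integral\<^sup>L lborel \<psi> = inverse t ^ ?d * I\<phi>"
      using integral_affine[of t \<phi> "(- t) *\<^sub>R x0"] t
      by (simp add: \<psi>_def I\<phi>_def power_inverse field_simps)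
    have g\<psi>: "foldr partial_deriv is \<psi> = (\<lambda>x. t ^ ?d * g (t *\<^sub>R x + (- t) *\<^sub>R x0))"
      using foldr_partial_affine[OF open_UNIV \<phi>Ck, of t _ "(- t) *\<^sub>R x0" "is"] len
      by (simp add: \<psi>_def g_def fun_eq_iff)
    have "integrable lborel (\<lambda>x. t ^ ?d * g (t *\<^sub>R x + (- t) *\<^sub>R x0))"
      using t by (intro integrable_mult_right integrable_affine gint) auto
    then have "(\<integral>x. foldr partial_deriv is \<psi> x *\<^sub>R convolution f sign_kernel x \<partial>lborel)
        = (\<integral>z. f z *\<^sub>R sign_correlation (\<lambda>x. t ^ ?d * g (t *\<^sub>R x + (- t) *\<^sub>R x0)) z \<partial>lborel)"
      unfolding g\<psi> by (rule conv_corr_adjoint[OF fint])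
    also have "\<dots> = (\<integral>z. f z *\<^sub>R sign_correlation g (t *\<^sub>R (z - x0)) \<partial>lborel)"
      using t by (subst corr_rescale) auto
    finally have P: "(\<integral>x. foldr partial_deriv is \<psi> x *\<^sub>R convolution f sign_kernel x \<partial>lborel)
        = (\<integral>z. f z *\<^sub>R sign_correlation g (t *\<^sub>R (z - x0)) \<partial>lborel)" (is "?P = _") .
    have "integrable lborel (\<lambda>z. f z *\<^sub>R sign_correlation g (t *\<^sub>R (z - x0)))"
    proof (rule compactly_supported_integrable)
      show "continuous_on UNIV (\<lambda>z. f z *\<^sub>R sign_correlation g (t *\<^sub>R (z - x0)))"
        by (intro continuous_intros fcont continuous_on_compose2[OF corrcont]) auto
      show "norm z \<le> norm x0 + R" if "f z *\<^sub>R sign_correlation g (t *\<^sub>R (z - x0)) \<noteq> 0" for z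
        using fsupp'[of z] that by auto
    qed
    then have "?P \<bullet> p = (\<integral>z. (f z *\<^sub>R sign_correlation g (t *\<^sub>R (z - x0))) \<bullet> p \<partial>lborel)"
      unfolding P by (intro integral_inner_left[symmetric])
    also have "\<dots> = (\<integral>z. f0 (z - x0) * L (t *\<^sub>R (z - x0)) \<partial>lborel) / I0"
      by (simp add: f_def L_def)
    also have "(\<integral>z. f0 (z - x0) * L (t *\<^sub>R (z - x0)) \<partial>lborel) = (\<integral>z. f0 z * L (t *\<^sub>R z) \<partial>lborel)"
    proof -
      have [measurable]: "L \<in> borel_measurable borel" using Lcont by (rule borel_measurable_continuous_onI)
      show ?thesis
        using integral_affine[of 1 "\<lambda>z. f0 z * L (t *\<^sub>R z)" "- x0"] by simp
    qed
    finally have Pp: "?P \<bullet> p = (\<integral>z. f0 z * L (t *\<^sub>R z) \<partial>lborel) / I0" .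
    have "C * integral\<^sup>L lborel \<psi> * norm p \<le> \<bar>C\<bar> * integral\<^sup>L lborel \<psi> * norm p"
      using I\<phi> t by (intro mult_right_mono) (auto simp: I\<psi>)
    also have "\<dots> = inverse t ^ ?d * (I0 * \<bar>C\<bar> * I\<phi> * norm p) / I0"
      using I0 by (simp add: I\<psi>)
    also have "\<dots> < inverse t ^ ?d * (c * I\<phi> * I\<beta> * (\<Sum>k<Suc N. inverse (real (Suc k))) - V) / I0"
      using N t I0 by (intro divide_strict_right_mono mult_strict_left_mono) auto
    also have "\<dots> \<le> ?P \<bullet> p"
      unfolding Pp using main[of N] I0 by (intro divide_right_mono) (auto simp: t_def)
    also have "\<dots> \<le> norm ?P * norm p" by (rule norm_cauchy_schwarz)
    finally have "C * integral\<^sup>L lborel \<psi> < norm ?P" using np(2) by simp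
    moreover have "0 \<le> \<psi> x" for x using \<phi>nonneg by (simp add: \<psi>_def)
    ultimately show "\<exists>\<psi>. (\<forall>k. \<psi> \<in> C_k k UNIV) \<and> (\<forall>x. 0 \<le> \<psi> x) \<and> (\<forall>x. \<psi> x \<noteq> 0 \<longrightarrow> norm (x - x0) \<le> R) \<and>
      C * integral\<^sup>L lborel \<psi> < norm (\<integral>x. foldr partial_deriv is \<psi> x *\<^sub>R convolution f sign_kernel x \<partial>lborel)"
      using \<psi>Ck \<psi>supp by blast
  qed
qed

section \<open>The counterexample\<close>

text \<open>
  At the excluded point \<open>z = x\<close> both integrands are \<open>0\<close>, because \<open>0 /\<^sub>R norm 0 = 0\<close>.
\<close>
lemma geometric_cdf_density:
  fixes f :: "real ^ 'n::finite \<Rightarrow> real"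
  assumes "continuous_on UNIV f" "\<And>x. 0 \<le> f x"
  shows "geometric_cdf (density lborel (\<lambda>x. ennreal (f x))) = convolution f sign_kernel"
proof
  fix x :: "real ^ 'n"
  have [measurable]: "f \<in> borel_measurable borel"
    using assms(1) by (rule borel_measurable_continuous_onI)
  have "indicator {z. z \<noteq> x} z *\<^sub>R ((x - z) /\<^sub>R norm (x - z)) = sign_kernel (x - z)" for z
    by (cases "z = x") (simp_all add: sign_kernel_def)
  then have "geometric_cdf (density lborel (\<lambda>x. ennreal (f x))) x
      = (\<integral>z. sign_kernel (x - z) \<partial>density lborel (\<lambda>x. ennreal (f x)))"
    by (simp add: geometric_cdf_def)
  also have "\<dots> = convolution f sign_kernel x"
    unfolding convolution_def by (subst integral_density) (use assms(2) in auto)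
  finally show "geometric_cdf (density lborel (\<lambda>x. ennreal (f x))) x = convolution f sign_kernel x" .
qed

lemma ex_count_list:
  fixes \<alpha> :: "'n::finite \<Rightarrow> nat"
  shows "\<exists>is. \<forall>i. count_list is i = \<alpha> i"
proof -
  have "\<exists>is. \<forall>i. count_list is i = (if i \<in> A then \<alpha> i else 0)" if "finite A" for A
    using that
  proof induction
    case empty
    show ?case by (rule exI[of _ "[]"]) simp
  next
    case (insert a A)
    then obtain "is" where cnt: "\<forall>i. count_list is i = (if i \<in> A then \<alpha> i else 0)" by blast
    have rep: "count_list (replicate n a) i = (if i = a then n else 0)" for n i
      by (induction n) auto
    show ?case
      by (rule exI[of _ "replicate (\<alpha> a) a @ is"]) (use insert.hyps cnt rep in auto)
  qed
  from this[of UNIV] show ?thesis by simp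
qed

lemma multi_deriv_eq_foldr:
  fixes \<alpha> :: "'n::finite \<Rightarrow> nat"
  obtains "is" where "length is = (\<Sum>i\<in>UNIV. \<alpha> i)"
    "\<And>f :: real ^ 'n \<Rightarrow> 'b::real_normed_vector. multi_deriv \<alpha> f = foldr partial_deriv is f"
proof -
  let ?is = "SOME is. \<forall>i. count_list is i = \<alpha> i"
  have "\<forall>i. count_list ?is i = \<alpha> i" by (rule someI_ex[OF ex_count_list])
  then have "length ?is = (\<Sum>i\<in>UNIV. \<alpha> i)"
    using sum_count_set[of ?is UNIV] by simp
  then show ?thesis by (rule that) (simp add: multi_deriv_def)
qed

theorem proposition4p2:
  fixes \<Omega> :: "(real ^ 'n::finite) set" and \<alpha> :: "'n \<Rightarrow> nat"
  assumes "CARD('n) \<ge> 2"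
    and "open \<Omega>" and "\<Omega> \<noteq> {}"
    and "(\<Sum>i\<in>UNIV. \<alpha> i) = CARD('n)"
  shows "\<exists>(P :: (real ^ 'n) measure) (f :: real ^ 'n \<Rightarrow> real).
           prob_space P \<and> sets P = sets borel \<and>
           f \<in> C0_c \<Omega> \<and> (\<forall>x. 0 \<le> f x) \<and> P = density lborel (\<lambda>x. ennreal (f x)) \<and>
           \<not> restricts_to_L_infinity \<Omega>
               (distributional_deriv \<alpha> (distribution_of (geometric_cdf P))) \<and>
           geometric_cdf P \<in> C_k (CARD('n) - 1) UNIV - C_k CARD('n) \<Omega>"
proof -
  obtain x0 where "x0 \<in> \<Omega>" using assms(3) by blast
  then obtain R where R: "R > 0" "cball x0 R \<subseteq> \<Omega>"
    using assms(2) open_contains_cball by blast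
  obtain "is" where len: "length is = CARD('n)"
    and multi: "\<And>\<psi> :: real ^ 'n \<Rightarrow> real. multi_deriv \<alpha> \<psi> = foldr partial_deriv is \<psi>"
    using multi_deriv_eq_foldr[of \<alpha>] assms(4) by metis
  obtain f :: "real ^ 'n \<Rightarrow> real" where f: "continuous_on UNIV f" "\<And>x. 0 \<le> f x"
    "\<And>x. f x \<noteq> 0 \<Longrightarrow> norm (x - x0) \<le> R" "integrable lborel f" "integral\<^sup>L lborel f = 1"
    and unbounded: "\<And>C. \<exists>\<psi>. (\<forall>k. \<psi> \<in> C_k k UNIV) \<and> (\<forall>x. 0 \<le> \<psi> x) \<and>
      (\<forall>x. \<psi> x \<noteq> 0 \<longrightarrow> norm (x - x0) \<le> R) \<and>
      C * integral\<^sup>L lborel \<psi> < norm (\<integral>x. foldr partial_deriv is \<psi> x *\<^sub>R convolution f sign_kernel x \<partial>lborel)"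
    using unbounded_derivative_functional[OF assms(1) len R(1)] by blast
  define P where "P = density lborel (\<lambda>x. ennreal (f x))"
  define F where "F = convolution f sign_kernel"
  have cdf: "geometric_cdf P = F" unfolding P_def F_def by (rule geometric_cdf_density[OF f(1,2)])
  have compact_support: "compact_support_in \<Omega> h"
    if "\<And>x. h x \<noteq> 0 \<Longrightarrow> norm (x - x0) \<le> R" for h :: "real ^ 'n \<Rightarrow> real"
  proof -
    have "closure {x. h x \<noteq> 0} \<subseteq> cball x0 R"
      by (rule closure_minimal) (use that in \<open>auto simp: dist_norm norm_minus_commute\<close>)
    then show ?thesis
      using R(2) compact_Int_closed[of "cball x0 R" "closure {x. h x \<noteq> 0}"]
      by (auto simp: compact_support_in_def Int_absorb1)
  qed
  have fsupp: "norm x \<le> norm x0 + R" if "f x \<noteq> 0" for x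
    using f(3)[OF that] norm_triangle_ineq2[of x x0] by linarith
  have FC: "F \<in> C_k (CARD('n) - 1) UNIV"
    unfolding F_def
    by (rule conv_C_k[OF assms(1) f(1) fsupp smooth_homogeneous_sign_kernel]) (use assms(1) in auto)
  have Fcont: "continuous_on UNIV F" by (rule C_k_continuous_on[OF FC])
  then have [measurable]: "F \<in> borel_measurable borel" by (rule borel_measurable_continuous_onI)
  from choice[OF allI[OF unbounded]] obtain \<psi> where \<psi>_all:
    "\<forall>C. (\<forall>k. \<psi> C \<in> C_k k UNIV) \<and> (\<forall>x. 0 \<le> \<psi> C x) \<and>
      (\<forall>x. \<psi> C x \<noteq> 0 \<longrightarrow> norm (x - x0) \<le> R) \<and>
      C * integral\<^sup>L lborel (\<psi> C) < norm (\<integral>x. foldr partial_deriv is (\<psi> C) x *\<^sub>R convolution f sign_kernel x \<partial>lborel)"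
    ..
  then have \<psi>: "\<And>C k. \<psi> C \<in> C_k k UNIV" "\<And>C x. 0 \<le> \<psi> C x"
    "\<And>C x. \<psi> C x \<noteq> 0 \<Longrightarrow> norm (x - x0) \<le> R"
    "\<And>C. C * integral\<^sup>L lborel (\<psi> C) < norm (\<integral>x. foldr partial_deriv is (\<psi> C) x *\<^sub>R F x \<partial>lborel)"
    unfolding F_def by simp_all
  have test: "\<psi> C \<in> test_functions \<Omega>" for C
    using \<psi>(1) compact_support[OF \<psi>(3)] by (simp add: test_functions_def)
  have \<psi>int: "integrable lborel (\<psi> C)" for C
    using test_functions_scaleR_integrable[OF assms(2) test, of "\<lambda>_. 1 :: real"] by simp
  have \<psi>cont: "continuous_on UNIV (\<psi> C)" for C by (rule test_functions_continuous[OF test])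

  have "prob_space P"
  proof (rule prob_spaceI)
    have [measurable]: "f \<in> borel_measurable borel" using f(4) by auto
    have "emeasure P (space P) = (\<integral>\<^sup>+x. ennreal (f x) \<partial>lborel)"
      by (simp add: P_def emeasure_density)
    also have "\<dots> = 1" using nn_integral_eq_integral[OF f(4)] f(2,5) by simp
    finally show "emeasure P (space P) = 1" .
  qed
  moreover have "sets P = sets borel" by (simp add: P_def)
  moreover have "f \<in> C0_c \<Omega>" using f(1) compact_support[OF f(3)] by (simp add: C0_c_def)
  moreover have "\<not> restricts_to_L_infinity \<Omega> (distributional_deriv \<alpha> (distribution_of F))"
  proof
    assume "restricts_to_L_infinity \<Omega> (distributional_deriv \<alpha> (distribution_of F))"
    then obtain h C where h: "h \<in> borel_measurable (lebesgue_on \<Omega>)" "AE x in lebesgue_on \<Omega>. norm (h x) \<le> C"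
      and eq: "\<And>\<phi>. \<phi> \<in> test_functions \<Omega> \<Longrightarrow>
        distributional_deriv \<alpha> (distribution_of F) \<phi> = (\<integral>x. \<phi> x *\<^sub>R h x \<partial>lebesgue_on \<Omega>)"
      unfolding restricts_to_L_infinity_def L_infinity_def by blast
    have \<Omega>: "\<Omega> \<in> sets lebesgue" using assms(2) by simp
    have [measurable]: "\<psi> C \<in> borel_measurable borel" using \<psi>int by auto
    have restrict: "indicator \<Omega> x * \<psi> C x = \<psi> C x" for x
      using test_functions_outside[OF test, of x] by (cases "x \<in> \<Omega>") auto
    have int\<Omega>: "integrable (lebesgue_on \<Omega>) (\<psi> C)"
      using \<psi>int[of C] \<Omega> by (subst integrable_restrict_space) (auto simp: set_integrable_def restrict integrable_completion)
    have int_eq: "(\<integral>x. \<psi> C x \<partial>lebesgue_on \<Omega>) = integral\<^sup>L lborel (\<psi> C)"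
      using \<Omega> by (subst integral_restrict_space) (auto simp: set_lebesgue_integral_def restrict integral_completion)
    have bound: "AE x in lebesgue_on \<Omega>. norm (\<psi> C x *\<^sub>R h x) \<le> C * \<psi> C x"
      using h(2)
    proof eventually_elim
      case (elim x)
      then show ?case using mult_left_mono[OF elim \<psi>(2)[of C x]] \<psi>(2)[of C x] by (simp add: mult.commute)
    qed
    have meas: "\<psi> C \<in> borel_measurable (lebesgue_on \<Omega>)" using int\<Omega> by auto
    have inth: "integrable (lebesgue_on \<Omega>) (\<lambda>x. \<psi> C x *\<^sub>R h x)"
      by (rule Bochner_Integration.integrable_bound[OF integrable_mult_right[OF int\<Omega>, of C]])
        (use h(1) meas bound in \<open>auto intro: AE_mp[OF bound] simp: order_trans[OF _ abs_ge_self]\<close>)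
    have "foldr partial_deriv is (\<psi> C) \<in> test_functions \<Omega>" by (rule test_functions_foldr[OF test])
    then have "continuous_on UNIV (\<lambda>x. foldr partial_deriv is (\<psi> C) x *\<^sub>R F x)"
      by (intro continuous_intros test_functions_continuous Fcont)
    then have [measurable]: "(\<lambda>x. foldr partial_deriv is (\<psi> C) x *\<^sub>R F x) \<in> borel_measurable borel"
      by (rule borel_measurable_continuous_onI)
    have "norm (\<integral>x. foldr partial_deriv is (\<psi> C) x *\<^sub>R F x \<partial>lborel)
        = norm (distributional_deriv \<alpha> (distribution_of F) (\<psi> C))"
      by (simp add: distributional_deriv_def distribution_of_def multi integral_completion)
    also have "\<dots> = norm (\<integral>x. \<psi> C x *\<^sub>R h x \<partial>lebesgue_on \<Omega>)" by (simp only: eq[OF test])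
    also have "\<dots> \<le> (\<integral>x. norm (\<psi> C x *\<^sub>R h x) \<partial>lebesgue_on \<Omega>)" by (rule integral_norm_bound)
    also have "\<dots> \<le> (\<integral>x. C * \<psi> C x \<partial>lebesgue_on \<Omega>)"
      by (intro integral_mono_AE integrable_norm inth integrable_mult_right int\<Omega> bound)
    also have "\<dots> = C * integral\<^sup>L lborel (\<psi> C)" by (simp add: int_eq)
    finally show False using \<psi>(4)[of C] by simp
  qed
  moreover have "F \<notin> C_k CARD('n) \<Omega>"
  proof
    assume "F \<in> C_k CARD('n) \<Omega>"
    then have F: "F \<in> C_k (length is) \<Omega>" by (simp add: len)
    let ?G = "foldr partial_deriv (rev is) F"
    have Gcont: "continuous_on \<Omega> ?G"
      by (rule C_k_continuous_on[OF C_k_foldr[where k = 0]]) (use F in simp)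
    then have "compact (?G ` cball x0 R)"
      by (intro compact_continuous_image continuous_on_subset[OF _ R(2)]) auto
    then obtain C where C: "\<And>x. x \<in> cball x0 R \<Longrightarrow> norm (?G x) \<le> C"
      using compact_imp_bounded bounded_iff by (metis imageI)
    have bound: "norm (\<psi> C x *\<^sub>R ?G x) \<le> C * \<psi> C x" for x
    proof (cases "\<psi> C x = 0")
      case False
      then have "x \<in> cball x0 R" using \<psi>(3)[OF False] by (simp add: dist_norm norm_minus_commute)
      then show ?thesis using mult_left_mono[OF C \<psi>(2)[of C x]] \<psi>(2)[of C x] by (simp add: mult.commute)
    qed simp
    have "norm (\<integral>x. foldr partial_deriv is (\<psi> C) x *\<^sub>R F x \<partial>lborel) = norm (\<integral>x. \<psi> C x *\<^sub>R ?G x \<partial>lborel)"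
      by (simp add: iterated_integration_by_parts[OF assms(2) test F])
    also have "\<dots> \<le> (\<integral>x. norm (\<psi> C x *\<^sub>R ?G x) \<partial>lborel)" by (rule integral_norm_bound)
    also have "\<dots> \<le> (\<integral>x. C * \<psi> C x \<partial>lborel)"
      by (intro integral_mono integrable_norm integrable_mult_right \<psi>int bound
          test_functions_scaleR_integrable[OF assms(2) test Gcont])
    finally show False using \<psi>(4)[of C] by simp
  qed
  ultimately have "prob_space P \<and> sets P = sets borel \<and>
           f \<in> C0_c \<Omega> \<and> (\<forall>x. 0 \<le> f x) \<and> P = density lborel (\<lambda>x. ennreal (f x)) \<and>
           \<not> restricts_to_L_infinity \<Omega>
               (distributional_deriv \<alpha> (distribution_of (geometric_cdf P))) \<and>
           geometric_cdf P \<in> C_k (CARD('n) - 1) UNIV - C_k CARD('n) \<Omega>"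
    using f(2) FC unfolding cdf by (simp add: P_def)
  then show ?thesis by blast
qed

end
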